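(* Let $X$ be a nonzero real Banach lattice. If $\tilde\varepsilon_{0,m}(X)+\alpha(X)<2$, then $X$ is superreflexive.
   Context: For a Banach lattice $X$, $S_X^+$ (respectively $B_X^+$) denotes the set of positive elements $x\in X$ ($x\ge0$) with $\|x\|=1$ (respectively $\|x\|\le 1$). The upper modulus of monotonicity of $X$ is $\sigma_X(\varepsilon)=\inf\{\|x+\varepsilon y\|-1 : x,y\in S_X^+\}$ for $\varepsilon\in[0,1]$, and $\tilde\varepsilon_{0,m}(X)=\sup\{\varepsilon\in[0,1) : \sigma_X(\varepsilon)=0\}$. The Riesz angle of $X$ is $\alpha(X)=\sup\{\|x\vee y\| : x,y\in B_X^+\}$. *)

theory Defs
  imports "HOL-Analysis.Analysis" "HOL-Library.Lattice_Algebras"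
begin

class banach_lattice = banach + ordered_real_vector + lattice_ab_group_add_abs +
  assumes norm_mono_abs: "\<bar>x\<bar> \<le> \<bar>y\<bar> \<Longrightarrow> norm x \<le> norm y"

definition pos_sphere :: "'a::banach_lattice set" where
  "pos_sphere = {x. 0 \<le> x \<and> norm x = 1}"

definition pos_ball :: "'a::banach_lattice set" where
  "pos_ball = {x. 0 \<le> x \<and> norm x \<le> 1}"

text \<open>The infima and suprema below are those of the reals. All the sets involved are bounded,
  and they are nonempty as soon as the space is nonzero (for \<^term>\<open>\<epsilon>\<close> in the unit interval).\<close>

definition upper_modulus :: "'a::banach_lattice itself \<Rightarrow> real \<Rightarrow> real" where
  "upper_modulus X \<epsilon> =
     Inf {norm (x + \<epsilon> *\<^sub>R y) - 1 | x y :: 'a. x \<in> pos_sphere \<and> y \<in> pos_sphere}"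

definition eps_tilde_0m :: "'a::banach_lattice itself \<Rightarrow> real" where
  "eps_tilde_0m X = Sup {\<epsilon>. 0 \<le> \<epsilon> \<and> \<epsilon> < 1 \<and> upper_modulus X \<epsilon> = 0}"

definition riesz_angle :: "'a::banach_lattice itself \<Rightarrow> real" where
  "riesz_angle X = Sup {norm (sup x y) | x y :: 'a. x \<in> pos_ball \<and> y \<in> pos_ball}"

text \<open>Reflexivity: the canonical embedding into the bidual is onto.\<close>

definition reflexive_space :: "'b::real_normed_vector itself \<Rightarrow> bool" where
  "reflexive_space Y \<longleftrightarrow>
     (\<forall>\<Phi> :: ('b \<Rightarrow>\<^sub>L real) \<Rightarrow>\<^sub>L real. \<exists>y. \<forall>f. blinfun_apply \<Phi> f = blinfun_apply f y)"

text \<open>Finite representability of \<^term>\<open>Y\<close> in \<^term>\<open>X\<close>, as defined by James. The sets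
  \<^term>\<open>span B\<close> with \<^term>\<open>B\<close> finite are exactly the finite-dimensional subspaces. Only the
  values of \<^term>\<open>T\<close> on \<^term>\<open>span B\<close> matter; the norm bounds make it an isomorphism
  onto its image there.\<close>

definition finitely_representable ::
    "'b::real_normed_vector itself \<Rightarrow> 'a::real_normed_vector itself \<Rightarrow> bool" where
  "finitely_representable Y X \<longleftrightarrow>
     (\<forall>B :: 'b set. \<forall>\<rho>>1. finite B \<longrightarrow>
        (\<exists>T :: 'b \<Rightarrow> 'a.
           (\<forall>u\<in>span B. \<forall>v\<in>span B. T (u + v) = T u + T v) \<and>
           (\<forall>c. \<forall>u\<in>span B. T (c *\<^sub>R u) = c *\<^sub>R T u) \<and>
           (\<forall>u\<in>span B. norm u / \<rho> \<le> norm (T u) \<and> norm (T u) \<le> \<rho> * norm u)))"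

text \<open>A Banach space is superreflexive if every Banach space finitely representable in it is
  reflexive. The Banach spaces finitely representable in a given one have unbounded cardinality,
  so the quantifier over them ranges over types and cannot be bound inside a HOL predicate. The
  test space is therefore a second type argument, and superreflexivity of \<^typ>\<open>'a\<close> is the
  schematic statement in which the type variable \<^typ>\<open>'b\<close> (of class \<^class>\<open>banach\<close>) is
  arbitrary. The predicate must only be asserted as a conclusion with \<^typ>\<open>'b\<close> free.\<close>

definition superreflexive :: "'a::banach itself \<Rightarrow> 'b::banach itself \<Rightarrow> bool" where
  "superreflexive X Y \<longleftrightarrow> (finitely_representable Y X \<longrightarrow> reflexive_space Y)"

end

theory Submission
  imports Defs "HOL-Library.Ramsey"
begin

text \<open>The link between the hypothesis and superreflexivity is uniform nonsquareness: there is \<open>\<kappa> < 1\<close> such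
that two vectors of the unit ball never have both their sum and their difference longer than \<open>2\<kappa>\<close>.

The lattice part shows that \<open>X\<close> is uniformly nonsquare. For \<open>x\<close>, \<open>y\<close> in the unit ball let
\<open>n = (\<bar>x\<bar> + \<bar>y\<bar> - \<bar>x + y\<bar>) / 2\<close>. Then \<open>\<bar>x + y\<bar> = (\<bar>x\<bar> - n) + (\<bar>y\<bar> - n)\<close> with \<open>0 \<le> n \<le> \<bar>x\<bar>, \<bar>y\<bar>\<close>, and
\<open>\<bar>x - y\<bar> \<le> \<bar>x\<bar> \<squnion> \<bar>y\<bar> + n\<close>. Fix \<open>\<epsilon>\<close> strictly between \<open>eps_tilde_0m TYPE('a)\<close> and \<open>2\<close>
minus the Riesz angle. If \<open>\<parallel>n\<parallel> \<ge> \<epsilon>\<close>, then positivity of the upper modulus at \<open>\<epsilon>\<close> keeps \<open>\<parallel>x + y\<parallel>\<close> away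
from 2; otherwise \<open>\<parallel>x - y\<parallel>\<close> is at most the Riesz angle plus \<open>\<epsilon>\<close>, which is less than 2 (lemma
\<open>uniformly_nonsquare_banach_lattice\<close>).

Uniform nonsquareness involves only two vectors at a time, so it passes to every space that is finitely
representable in \<open>X\<close> (lemma \<open>uniformly_nonsquare_finitely_representable\<close>). It remains to prove
James's theorem that a uniformly nonsquare Banach space is reflexive.

A nonreflexive Banach space contains a bounded sequence \<open>x\<close>, and its dual a bounded sequence \<open>f\<close>, with
\<open>f j (x k)\<close> equal to 1 for \<open>j < k\<close> and to 0 otherwise (lemma
\<open>bounded_staircase_if_not_reflexive\<close>). This follows from the Hahn-Banach theorem, proved here through
minimal sublinear functionals, and two finite interpolation results of Helly type. Consider then the
least norm of a vector on which the functionals take large values of alternating signs along \<open>n\<close>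
successive blocks of indices. After a passage to a subset of the indices by Ramsey's theorem, this
norm hardly depends on the position of the blocks, but only on \<open>n\<close>. Two near-minimizers for interlaced
blocks have a half sum that is again alternating along \<open>n\<close> blocks, and a half difference that is
alternating along \<open>n - 1\<close> blocks (lemma \<open>alternating_norm_growth\<close>). In a uniformly nonsquare space
the least norm would therefore grow geometrically with \<open>n\<close>; but it is at most linear in \<open>n\<close>, as
combinations of the \<open>x k\<close> show.\<close>

section \<open>Uniformly nonsquare spaces\<close>

text \<open>This is the uniform nonsquareness of James. In a plane whose unit ball is a square there are unit
vectors whose sum and difference both have norm 2; the condition keeps all planes of the space a fixed
amount away from this shape.\<close>

definition uniformly_nonsquare :: "'a::real_normed_vector itself \<Rightarrow> bool" where
  "uniformly_nonsquare X \<longleftrightarrow> (\<exists>\<kappa><1. \<forall>x y :: 'a. norm x \<le> 1 \<longrightarrow> norm y \<le> 1 \<longrightarrow>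
     norm (x + y) \<le> 2 * \<kappa> \<or> norm (x - y) \<le> 2 * \<kappa>)"

lemma nonsquare_scaled:
  fixes x y :: "'a::real_normed_vector"
  assumes \<kappa>: "\<And>x y :: 'a. norm x \<le> 1 \<Longrightarrow> norm y \<le> 1 \<Longrightarrow> norm (x + y) \<le> 2 * \<kappa> \<or> norm (x - y) \<le> 2 * \<kappa>"
    and "0 < r" "norm x \<le> r" "norm y \<le> r"
  shows "norm (x + y) \<le> 2 * \<kappa> * r \<or> norm (x - y) \<le> 2 * \<kappa> * r"
proof -
  have "norm ((1/r) *\<^sub>R x) \<le> 1" "norm ((1/r) *\<^sub>R y) \<le> 1" using assms by (simp_all add: field_simps)
  then have "norm ((1/r) *\<^sub>R (x + y)) \<le> 2 * \<kappa> \<or> norm ((1/r) *\<^sub>R (x - y)) \<le> 2 * \<kappa>"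
    using \<kappa> by (simp only: scaleR_add_right scaleR_diff_right)
  moreover have "norm ((1/r) *\<^sub>R v) = norm v / r" for v :: 'a using \<open>0 < r\<close> by simp
  ultimately show ?thesis using \<open>0 < r\<close> by (simp only: pos_divide_le_eq)
qed

text \<open>Nonsquareness involves two vectors at a time, so an almost isometric copy of their span transports
it. The distortion \<open>\<rho>\<close> enters twice, and \<open>\<rho>\<^sup>2 = 2 / (1 + \<kappa>)\<close> turns the constant \<open>\<kappa>\<close> into the number
\<open>2\<kappa> / (1 + \<kappa>)\<close>, which is still below 1.\<close>

lemma uniformly_nonsquare_finitely_representable:
  assumes fr: "finitely_representable TYPE('b::real_normed_vector) TYPE('a::real_normed_vector)"
    and ns: "uniformly_nonsquare TYPE('a)"
  shows "uniformly_nonsquare TYPE('b)"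
proof -
  obtain \<kappa> where \<kappa>: "\<kappa> < 1" "\<And>x y :: 'a. norm x \<le> 1 \<Longrightarrow> norm y \<le> 1 \<Longrightarrow>
     norm (x + y) \<le> 2 * \<kappa> \<or> norm (x - y) \<le> 2 * \<kappa>"
    using ns unfolding uniformly_nonsquare_def by blast
  have \<kappa>0: "0 \<le> \<kappa>" using \<kappa>(2)[of 0 0] by simp
  define \<rho> where "\<rho> = sqrt (2 / (1 + \<kappa>))"
  have \<rho>: "\<rho> > 1" using \<kappa>(1) \<kappa>0 by (simp add: \<rho>_def)
  have \<rho>2: "\<rho> * \<rho> = 2 / (1 + \<kappa>)" using \<kappa>0 by (simp add: \<rho>_def)
  define \<kappa>' where "\<kappa>' = \<rho> * \<rho> * \<kappa>"
  have "\<kappa>' < 1" unfolding \<kappa>'_def \<rho>2 using \<kappa>(1) \<kappa>0 by (simp add: field_simps)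
  moreover have "norm (u + v) \<le> 2 * \<kappa>' \<or> norm (u - v) \<le> 2 * \<kappa>'"
    if uv: "norm u \<le> 1" "norm v \<le> 1" for u v :: 'b
  proof -
    obtain T :: "'b \<Rightarrow> 'a" where
      add: "\<forall>u'\<in>span {u, v}. \<forall>v'\<in>span {u, v}. T (u' + v') = T u' + T v'" and
      scale: "\<forall>c. \<forall>u'\<in>span {u, v}. T (c *\<^sub>R u') = c *\<^sub>R T u'" and
      nrm: "\<forall>u'\<in>span {u, v}. norm u' / \<rho> \<le> norm (T u') \<and> norm (T u') \<le> \<rho> * norm u'"
      using fr[unfolded finitely_representable_def, rule_format, of \<rho> "{u, v}"] \<rho> by auto
    have u: "u \<in> span {u, v}" and v: "v \<in> span {u, v}" by (auto intro: span_base)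
    have Tadd: "T (u + v) = T u + T v" using add u v by blast
    have "T (u + (-1) *\<^sub>R v) = T u + T ((-1) *\<^sub>R v)" using add u v span_scale by blast
    then have Tdiff: "T (u - v) = T u - T v" using scale[rule_format, of v "-1"] v by simp
    have bnd: "norm ((1 / \<rho>) *\<^sub>R T w) \<le> 1" if "w \<in> span {u, v}" "norm w \<le> 1" for w
    proof -
      have "norm (T w) \<le> \<rho> * norm w" using nrm that by blast
      also have "\<dots> \<le> \<rho>" using that \<rho> by simp
      finally show ?thesis using \<rho> by (simp add: field_simps)
    qed
    have pull: "norm w \<le> 2 * \<kappa>'" if "w \<in> span {u, v}" "norm ((1 / \<rho>) *\<^sub>R T w) \<le> 2 * \<kappa>" for w
    proof -
      have "norm w \<le> \<rho> * norm (T w)" using nrm that(1) \<rho> by (simp add: field_simps)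
      also have "norm (T w) \<le> \<rho> * (2 * \<kappa>)" using that(2) \<rho> by (simp add: field_simps)
      finally show ?thesis using \<rho> by (simp add: \<kappa>'_def mult_ac)
    qed
    have "norm ((1 / \<rho>) *\<^sub>R T u + (1 / \<rho>) *\<^sub>R T v) \<le> 2 * \<kappa> \<or>
        norm ((1 / \<rho>) *\<^sub>R T u - (1 / \<rho>) *\<^sub>R T v) \<le> 2 * \<kappa>"
      using bnd u v uv by (intro \<kappa>(2)) blast+
    then have "norm ((1 / \<rho>) *\<^sub>R T (u + v)) \<le> 2 * \<kappa> \<or> norm ((1 / \<rho>) *\<^sub>R T (u - v)) \<le> 2 * \<kappa>"
      by (simp only: Tadd Tdiff scaleR_add_right scaleR_diff_right)
    then show ?thesis
      using pull span_add[OF u v] span_diff[OF u v] by blast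
  qed
  ultimately show ?thesis unfolding uniformly_nonsquare_def by blast
qed

section \<open>Banach lattices\<close>

lemma norm_mono_nonneg:
  fixes x y :: "'a::banach_lattice"
  assumes "0 \<le> x" "x \<le> y"
  shows "norm x \<le> norm y"
  using assms order_trans[OF assms] by (intro norm_mono_abs) simp

lemma norm_abs_lattice [simp]: "norm \<bar>x :: 'a::banach_lattice\<bar> = norm x"
  by (intro antisym norm_mono_abs) simp_all

lemma abs_in_pos_ball: "norm (x :: 'a::banach_lattice) \<le> 1 \<Longrightarrow> \<bar>x\<bar> \<in> pos_ball"
  by (simp add: pos_ball_def)

text \<open>The left side is the supremum of the four elements \<open>\<plusminus>(x + y) \<plusminus> (x - y)\<close>, that is, of \<open>\<plusminus>2x\<close> and
\<open>\<plusminus>2y\<close>.\<close>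

lemma abs_add_plus_abs_diff_le:
  fixes x y :: "'a::banach_lattice"
  shows "\<bar>x + y\<bar> + \<bar>x - y\<bar> \<le> 2 *\<^sub>R sup \<bar>x\<bar> \<bar>y\<bar>"
proof -
  define w where "w = sup \<bar>x\<bar> \<bar>y\<bar>"
  have b: "x \<le> w" "- x \<le> w" "y \<le> w" "- y \<le> w"
    unfolding w_def abs_lattice by (simp_all add: le_supI1 le_supI2)
  have two: "2 *\<^sub>R w = w + w" by (simp add: scaleR_2)
  have "\<bar>x - y\<bar> \<le> 2 *\<^sub>R w - \<bar>x + y\<bar>"
    if "x - y \<le> 2 *\<^sub>R w - \<bar>x + y\<bar>" "y - x \<le> 2 *\<^sub>R w - \<bar>x + y\<bar>"
    using that by (intro abs_leI) simp_all
  moreover have "\<bar>x + y\<bar> \<le> 2 *\<^sub>R w - (x - y)"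
    using add_mono[OF b(1) b(1)] add_mono[OF b(4) b(4)] 
    by (intro abs_leI) (simp_all add: two algebra_simps)
  moreover have "\<bar>x + y\<bar> \<le> 2 *\<^sub>R w - (y - x)"
    using add_mono[OF b(3) b(3)] add_mono[OF b(2) b(2)] 
    by (intro abs_leI) (simp_all add: two algebra_simps)
  ultimately show ?thesis
    unfolding w_def[symmetric] by (simp add: algebra_simps)
qed

lemma upper_modulus_le:
  fixes x y :: "'a::banach_lattice"
  assumes "x \<in> pos_sphere" "y \<in> pos_sphere" "0 \<le> \<epsilon>"
  shows "1 + upper_modulus TYPE('a) \<epsilon> \<le> norm (x + \<epsilon> *\<^sub>R y)"
proof -
  let ?S = "{norm (x + \<epsilon> *\<^sub>R y) - 1 | x y :: 'a. x \<in> pos_sphere \<and> y \<in> pos_sphere}"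
  have "bdd_below ?S"
    by (rule bdd_belowI[of _ "-1"]) auto
  moreover have "norm (x + \<epsilon> *\<^sub>R y) - 1 \<in> ?S" using assms by blast
  ultimately have "Inf ?S \<le> norm (x + \<epsilon> *\<^sub>R y) - 1" by (rule cInf_lower[rotated])
  then show ?thesis by (simp add: upper_modulus_def)
qed

lemma pos_sphere_nonempty:
  assumes "(x :: 'a::banach_lattice) \<noteq> 0"
  shows "(1 / norm x) *\<^sub>R \<bar>x\<bar> \<in> pos_sphere"
  using assms by (simp add: pos_sphere_def scaleR_nonneg_nonneg)

lemma upper_modulus_nonneg:
  assumes "(z :: 'a::banach_lattice) \<in> pos_sphere" "0 \<le> \<epsilon>"
  shows "0 \<le> upper_modulus TYPE('a) \<epsilon>"
  unfolding upper_modulus_def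
proof (rule cInf_greatest)
  show "{norm (x + \<epsilon> *\<^sub>R y) - 1 | x y :: 'a. x \<in> pos_sphere \<and> y \<in> pos_sphere} \<noteq> {}"
    using assms(1) by blast
next
  fix r assume "r \<in> {norm (x + \<epsilon> *\<^sub>R y) - 1 | x y :: 'a. x \<in> pos_sphere \<and> y \<in> pos_sphere}"
  then obtain x y :: 'a where xy: "x \<in> pos_sphere" "y \<in> pos_sphere" "r = norm (x + \<epsilon> *\<^sub>R y) - 1"
    by blast
  have "norm x \<le> norm (x + \<epsilon> *\<^sub>R y)"
    using xy assms(2) by (intro norm_mono_nonneg) (simp_all add: pos_sphere_def scaleR_nonneg_nonneg)
  then show "0 \<le> r" using xy by (simp add: pos_sphere_def)
qed

lemma upper_modulus_0:
  assumes "(z :: 'a::banach_lattice) \<in> pos_sphere"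
  shows "upper_modulus TYPE('a) 0 = 0"
proof -
  have "{norm (x + 0 *\<^sub>R y) - 1 | x y :: 'a. x \<in> pos_sphere \<and> y \<in> pos_sphere} = {0}"
    using assms by (auto simp: pos_sphere_def)
  then show ?thesis by (simp add: upper_modulus_def)
qed

lemma upper_modulus_pos:
  assumes "(z :: 'a::banach_lattice) \<in> pos_sphere"
    and "eps_tilde_0m TYPE('a) < \<epsilon>" "\<epsilon> < 1"
  shows "0 < \<epsilon>" "0 < upper_modulus TYPE('a) \<epsilon>"
proof -
  let ?E = "{\<epsilon>. 0 \<le> \<epsilon> \<and> \<epsilon> < 1 \<and> upper_modulus TYPE('a) \<epsilon> = 0}"
  have bdd: "bdd_above ?E" by (rule bdd_aboveI[of _ 1]) auto
  have "0 \<in> ?E" using upper_modulus_0[OF assms(1)] by simp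
  then have "0 \<le> eps_tilde_0m TYPE('a)"
    unfolding eps_tilde_0m_def by (rule cSup_upper[OF _ bdd])
  then show pos: "0 < \<epsilon>" using assms(2) by simp
  have "\<epsilon> \<notin> ?E"
    using cSup_upper[OF _ bdd, of \<epsilon>] assms(2) by (auto simp: eps_tilde_0m_def)
  then show "0 < upper_modulus TYPE('a) \<epsilon>"
    using pos assms(3) upper_modulus_nonneg[OF assms(1), of \<epsilon>] by simp
qed

lemma norm_sup_le_riesz_angle:
  fixes x y :: "'a::banach_lattice"
  assumes "x \<in> pos_ball" "y \<in> pos_ball"
  shows "norm (sup x y) \<le> riesz_angle TYPE('a)"
  unfolding riesz_angle_def
proof (rule cSup_upper)
  show "norm (sup x y) \<in> {norm (sup x y) | x y :: 'a. x \<in> pos_ball \<and> y \<in> pos_ball}"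
    using assms by blast
  show "bdd_above {norm (sup x y) | x y :: 'a. x \<in> pos_ball \<and> y \<in> pos_ball}"
  proof (rule bdd_aboveI[of _ 2], clarify)
    fix x y :: 'a assume "x \<in> pos_ball" "y \<in> pos_ball"
    then have *: "0 \<le> x" "0 \<le> y" "norm x \<le> 1" "norm y \<le> 1" by (auto simp: pos_ball_def)
    have "norm (sup x y) \<le> norm (x + y)"
      using * by (intro norm_mono_nonneg) (simp_all add: le_supI1)
    also have "\<dots> \<le> norm x + norm y" by (rule norm_triangle_ineq)
    finally show "norm (sup x y) \<le> 2" using * by simp
  qed
qed

text \<open>A strictly positive upper modulus makes the norm strictly monotone in a quantitative way: removing
from \<open>a\<close> a part \<open>n\<close> of norm at least \<open>\<epsilon>\<close> shrinks the norm below 1. With \<open>t = \<parallel>a - n\<parallel> \<le> 1\<close>, the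
vector \<open>a / t\<close> dominates a normalized \<open>a - n\<close> plus \<open>\<epsilon>\<close> times a normalized \<open>n\<close>.\<close>

lemma norm_diff_le_of_upper_modulus:
  fixes a n :: "'a::banach_lattice"
  assumes "0 \<le> n" "n \<le> a" "norm a \<le> 1" "0 < \<epsilon>" "\<epsilon> \<le> norm n"
    and "0 \<le> upper_modulus TYPE('a) \<epsilon>"
  shows "norm (a - n) \<le> 1 / (1 + upper_modulus TYPE('a) \<epsilon>)"
proof (cases "a = n")
  case True
  then show ?thesis using assms(6) by simp
next
  case False
  define t where "t = norm (a - n)"
  have t0: "t > 0" using False by (simp add: t_def)
  have "t \<le> norm a"
    unfolding t_def using assms by (intro norm_mono_nonneg) simp_all
  then have t1: "t \<le> 1" using assms by simp
  have n0: "norm n > 0" using assms(4,5) by linarith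
  have coef: "\<epsilon> * (1 / norm n) \<le> 1 / t"
  proof -
    have "\<epsilon> * (1 / norm n) \<le> 1" using assms n0 by simp
    also have "1 \<le> 1 / t" using t0 t1 by simp
    finally show ?thesis .
  qed
  have "1 + upper_modulus TYPE('a) \<epsilon> \<le>
      norm ((1 / t) *\<^sub>R (a - n) + \<epsilon> *\<^sub>R ((1 / norm n) *\<^sub>R n))"
    using assms t0 n0
    by (intro upper_modulus_le) (simp_all add: pos_sphere_def scaleR_nonneg_nonneg t_def)
  also have "\<dots> \<le> norm ((1 / t) *\<^sub>R a)"
  proof (rule norm_mono_nonneg)
    show "0 \<le> (1 / t) *\<^sub>R (a - n) + \<epsilon> *\<^sub>R ((1 / norm n) *\<^sub>R n)"
      using assms t0 n0 by (simp add: scaleR_nonneg_nonneg)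
    have "(\<epsilon> * (1 / norm n)) *\<^sub>R n \<le> (1 / t) *\<^sub>R n"
      using coef assms(1) by (rule scaleR_right_mono)
    then show "(1 / t) *\<^sub>R (a - n) + \<epsilon> *\<^sub>R ((1 / norm n) *\<^sub>R n) \<le> (1 / t) *\<^sub>R a"
      by (simp add: scaleR_diff_right algebra_simps)
  qed
  also have "\<dots> = norm a / t" using t0 by simp
  also have "\<dots> \<le> 1 / t" using t0 assms by (simp add: divide_right_mono)
  finally have "t * (1 + upper_modulus TYPE('a) \<epsilon>) \<le> 1"
    using t0 by (simp add: field_simps)
  then show ?thesis using assms(6) by (simp add: t_def field_simps)
qed

text \<open>Let \<open>n = (\<bar>x\<bar> + \<bar>y\<bar> - \<bar>x + y\<bar>) / 2\<close>; it measures how much of \<open>x\<close> and \<open>y\<close> cancels in \<open>x + y\<close>, and it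
lies below both \<open>\<bar>x\<bar>\<close> and \<open>\<bar>y\<bar>\<close>. If \<open>n\<close> is large in norm, then \<open>\<bar>x + y\<bar> = (\<bar>x\<bar> - n) + (\<bar>y\<bar> - n)\<close> is
short because of the upper modulus of monotonicity. If \<open>n\<close> is small in norm, then
\<open>\<bar>x - y\<bar> \<le> \<bar>x\<bar> \<squnion> \<bar>y\<bar> + n\<close> is short because of the Riesz angle. The hypothesis leaves room for one
threshold \<open>\<epsilon>\<close> that serves both cases.\<close>

lemma uniformly_nonsquare_banach_lattice:
  assumes nz: "(z :: 'a::banach_lattice) \<noteq> 0"
    and less: "eps_tilde_0m TYPE('a) + riesz_angle TYPE('a) < 2"
  shows "uniformly_nonsquare TYPE('a)"
proof -
  define e where "e = eps_tilde_0m TYPE('a)"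
  define \<alpha> where "\<alpha> = riesz_angle TYPE('a)"
  define s where "s = (1 / norm z) *\<^sub>R \<bar>z\<bar>"
  have s: "s \<in> pos_sphere" unfolding s_def by (rule pos_sphere_nonempty[OF nz])
  then have "norm (sup s s) \<le> \<alpha>"
    unfolding \<alpha>_def by (intro norm_sup_le_riesz_angle) (simp_all add: pos_sphere_def pos_ball_def)
  then have \<alpha>: "1 \<le> \<alpha>" using s by (simp add: pos_sphere_def)
  \<comment> \<open>Any number strictly between \<open>e\<close> and \<open>2 - \<alpha>\<close> would do; it is below 1 because \<open>\<alpha> \<ge> 1\<close>.\<close>
  define \<epsilon> where "\<epsilon> = (e + (2 - \<alpha>)) / 2"
  have \<epsilon>: "e < \<epsilon>" "\<epsilon> < 2 - \<alpha>" using less by (auto simp: \<epsilon>_def e_def \<alpha>_def)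
  define \<sigma> where "\<sigma> = upper_modulus TYPE('a) \<epsilon>"
  have \<epsilon>0: "0 < \<epsilon>" and \<sigma>0: "0 < \<sigma>"
    using upper_modulus_pos[OF s, of \<epsilon>] \<epsilon> \<alpha> by (auto simp: e_def \<sigma>_def)
  define \<kappa> where "\<kappa> = max (\<alpha> + \<epsilon>) (1 + 1 / (1 + \<sigma>)) / 2"
  have "1 / (1 + \<sigma>) < 1" using \<sigma>0 by simp
  then have \<kappa>1: "\<kappa> < 1" using \<epsilon> unfolding \<kappa>_def max_def by (auto split: if_splits)
  have "norm (x + y) \<le> 2 * \<kappa> \<or> norm (x - y) \<le> 2 * \<kappa>" if xy: "norm x \<le> 1" "norm y \<le> 1" for x y :: 'a
  proof -
    define n where "n = (1/2) *\<^sub>R (\<bar>x\<bar> + \<bar>y\<bar> - \<bar>x + y\<bar>)"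
    have two_n: "n + n = \<bar>x\<bar> + \<bar>y\<bar> - \<bar>x + y\<bar>"
      unfolding n_def by (simp flip: scaleR_left_distrib)
    have half: "u \<le> v" if "u + u \<le> v + v" for u v :: 'a
    proof -
      have "(1/2) *\<^sub>R (u + u) \<le> (1/2) *\<^sub>R (v + v)" using that by (intro scaleR_left_mono) simp_all
      then show ?thesis by (simp flip: scaleR_2)
    qed
    have n0: "0 \<le> n"
      using abs_triangle_ineq[of x y] by (rule half[of 0 n, unfolded two_n, simplified])
    have "\<bar>y\<bar> \<le> \<bar>x + y\<bar> + \<bar>x\<bar>" "\<bar>x\<bar> \<le> \<bar>x + y\<bar> + \<bar>y\<bar>"
      using abs_triangle_ineq4[of "x + y" x] abs_triangle_ineq4[of "x + y" y] by simp_all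
    then have twice: "n + n \<le> \<bar>x\<bar> + \<bar>x\<bar>" "n + n \<le> \<bar>y\<bar> + \<bar>y\<bar>"
      unfolding two_n by (simp_all add: algebra_simps)
    have nx: "n \<le> \<bar>x\<bar>" by (rule half[OF twice(1)])
    have ny: "n \<le> \<bar>y\<bar>" by (rule half[OF twice(2)])
    show ?thesis
    proof (cases "\<epsilon> \<le> norm n")
      case True
      have "norm (x + y) = norm ((\<bar>x\<bar> - n) + (\<bar>y\<bar> - n))"
      proof -
        have "(\<bar>x\<bar> - n) + (\<bar>y\<bar> - n) = \<bar>x + y\<bar>"
          using two_n by (simp add: algebra_simps)
        then show ?thesis by simp
      qed
      also have "\<dots> \<le> norm (\<bar>x\<bar> - n) + norm (\<bar>y\<bar> - n)" by (rule norm_triangle_ineq)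
      also have "norm (\<bar>x\<bar> - n) \<le> 1 / (1 + \<sigma>)"
        unfolding \<sigma>_def using n0 nx xy \<epsilon>0 True \<sigma>0
        by (intro norm_diff_le_of_upper_modulus) (simp_all add: \<sigma>_def)
      also have "norm (\<bar>y\<bar> - n) \<le> norm \<bar>y\<bar>"
        using n0 ny by (intro norm_mono_nonneg) simp_all
      finally have "norm (x + y) \<le> 1 + 1 / (1 + \<sigma>)" using xy by simp
      also have "\<dots> \<le> 2 * \<kappa>" by (simp add: \<kappa>_def)
      finally show ?thesis by simp
    next
      case False
      define w where "w = sup \<bar>x\<bar> \<bar>y\<bar>"
      have "\<bar>x + y\<bar> + \<bar>x - y\<bar> \<le> w + w"
        using abs_add_plus_abs_diff_le[of x y] by (simp add: w_def scaleR_2)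
      then have "\<bar>x - y\<bar> + (\<bar>x + y\<bar> + \<bar>x - y\<bar>) \<le> (\<bar>x\<bar> + \<bar>y\<bar>) + (w + w)"
        using abs_triangle_ineq4[of x y] by (rule add_mono[rotated])
      then have "\<bar>x - y\<bar> + \<bar>x - y\<bar> \<le> w + w + (n + n)"
        unfolding two_n by (simp add: algebra_simps)
      then have "\<bar>x - y\<bar> + \<bar>x - y\<bar> \<le> (w + n) + (w + n)" by (simp add: algebra_simps)
      then have "\<bar>x - y\<bar> \<le> w + n" by (rule half)
      then have "norm \<bar>x - y\<bar> \<le> norm (w + n)" by (intro norm_mono_nonneg) simp_all
      also have "\<dots> \<le> norm w + norm n" by (rule norm_triangle_ineq)
      also have "norm w \<le> \<alpha>"
        unfolding w_def \<alpha>_def using xy by (intro norm_sup_le_riesz_angle abs_in_pos_ball)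
      finally have "norm (x - y) \<le> \<alpha> + \<epsilon>" using False by simp
      also have "\<dots> \<le> 2 * \<kappa>" by (simp add: \<kappa>_def)
      finally show ?thesis by simp
    qed
  qed
  then show ?thesis unfolding uniformly_nonsquare_def using \<kappa>1 by blast
qed

section \<open>The Hahn-Banach theorem\<close>

definition sublinear :: "('a::real_vector \<Rightarrow> real) \<Rightarrow> bool" where
  "sublinear p \<longleftrightarrow> (\<forall>x y. p (x + y) \<le> p x + p y) \<and> (\<forall>c\<ge>0. \<forall>x. p (c *\<^sub>R x) = c * p x)"

lemma sublinear_add: "sublinear p \<Longrightarrow> p (x + y) \<le> p x + p y"
  and sublinear_scale: "sublinear p \<Longrightarrow> 0 \<le> c \<Longrightarrow> p (c *\<^sub>R x) = c * p x"
  by (auto simp: sublinear_def)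

lemma sublinear_0 [simp]: "sublinear p \<Longrightarrow> p 0 = 0"
  using sublinear_scale[of p 0 0] by simp

lemma sublinear_ge: "sublinear p \<Longrightarrow> - p (- x) \<le> p x"
  using sublinear_add[of p x "- x"] by simp

lemma sublinearI:
  assumes add: "\<And>x y. p (x + y) \<le> p x + p y" and zero: "p 0 = 0"
    and scale: "\<And>c x. 0 < c \<Longrightarrow> p (c *\<^sub>R x) \<le> c * p x"
  shows "sublinear p"
  unfolding sublinear_def
proof (intro conjI allI impI add)
  fix c :: real and x
  assume "0 \<le> c"
  show "p (c *\<^sub>R x) = c * p x"
  proof (cases "c = 0")
    case False
    then have c: "0 < c" using \<open>0 \<le> c\<close> by simp
    have "p ((1 / c) *\<^sub>R (c *\<^sub>R x)) \<le> (1 / c) * p (c *\<^sub>R x)" using c by (intro scale) simp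
    then have "c * p x \<le> p (c *\<^sub>R x)" using c by (simp add: field_simps)
    with scale[OF c, of x] show ?thesis by simp
  qed (simp add: zero)
qed

lemma sublinear_norm: "0 \<le> c \<Longrightarrow> sublinear (\<lambda>x. c * norm x)"
  by (simp add: sublinear_def norm_triangle_ineq flip: distrib_left)
    (simp add: mult_left_mono norm_triangle_ineq)

definition convex_cone_with_0 :: "'a::real_vector set \<Rightarrow> bool" where
  "convex_cone_with_0 S \<longleftrightarrow> 0 \<in> S \<and> (\<forall>s\<in>S. \<forall>t\<in>S. s + t \<in> S) \<and> (\<forall>c\<ge>0. \<forall>s\<in>S. c *\<^sub>R s \<in> S)"

lemma subspace_convex_cone: "subspace S \<Longrightarrow> convex_cone_with_0 S"
  by (simp add: convex_cone_with_0_def subspace_0 subspace_add subspace_scale)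

lemma ray_convex_cone: "convex_cone_with_0 {t *\<^sub>R y | t. 0 \<le> t}"
  unfolding convex_cone_with_0_def
proof (intro conjI ballI allI impI)
  show "0 \<in> {t *\<^sub>R y | t. 0 \<le> t}" by (intro CollectI exI[of _ 0]) simp
  show "s + t \<in> {t *\<^sub>R y | t. 0 \<le> t}"
    if "s \<in> {t *\<^sub>R y | t. 0 \<le> t}" "t \<in> {t *\<^sub>R y | t. 0 \<le> t}" for s t
    using that by (auto simp flip: scaleR_left_distrib intro: add_nonneg_nonneg)
  show "c *\<^sub>R s \<in> {t *\<^sub>R y | t. 0 \<le> t}" if "0 \<le> c" "s \<in> {t *\<^sub>R y | t. 0 \<le> t}" for c s
    using that by (auto intro: mult_nonneg_nonneg)
qed

lemma sublinear_add_on_ray: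
  assumes p: "sublinear p" and "s \<in> {t *\<^sub>R y | t. 0 \<le> t}" "t \<in> {t *\<^sub>R y | t. 0 \<le> t}"
  shows "p (s + t) = p s + p t"
proof -
  obtain a b where "s = a *\<^sub>R y" "0 \<le> a" "t = b *\<^sub>R y" "0 \<le> b" using assms(2,3) by auto
  then show ?thesis
    by (simp add: sublinear_scale[OF p] distrib_right flip: scaleR_left_distrib)
qed

text \<open>The infimal convolution that forces a sublinear functional down along a cone. It is finite because
\<open>\<phi> \<le> p\<close> gives the lower bound \<open>- p (- x)\<close>. A linear \<open>g \<le> q\<close> satisfies \<open>g (- s) \<le> - \<phi> s\<close>, hence
dominates \<open>\<phi>\<close> on the cone; this is how extension problems are turned into domination problems.\<close>

lemma sublinear_relax_along_cone:
  fixes p :: "'a::real_vector \<Rightarrow> real"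
  assumes p: "sublinear p" and S: "convex_cone_with_0 S"
    and \<phi>_add: "\<And>s t. s \<in> S \<Longrightarrow> t \<in> S \<Longrightarrow> \<phi> (s + t) = \<phi> s + \<phi> t"
    and \<phi>_scale: "\<And>c s. 0 \<le> c \<Longrightarrow> s \<in> S \<Longrightarrow> \<phi> (c *\<^sub>R s) = c * \<phi> s"
    and \<phi>_le: "\<And>s. s \<in> S \<Longrightarrow> \<phi> s \<le> p s"
  defines "q \<equiv> \<lambda>x. INF s\<in>S. p (x + s) - \<phi> s"
  shows "sublinear q" "q x \<le> p x" "s \<in> S \<Longrightarrow> q (- s) \<le> - \<phi> s"
proof -
  have S0: "0 \<in> S" and S_add: "\<And>s t. s \<in> S \<Longrightarrow> t \<in> S \<Longrightarrow> s + t \<in> S"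
    and S_scale: "\<And>c s. 0 \<le> c \<Longrightarrow> s \<in> S \<Longrightarrow> c *\<^sub>R s \<in> S"
    using S by (auto simp: convex_cone_with_0_def)
  have \<phi>0: "\<phi> 0 = 0" using \<phi>_scale[of 0 0] S0 by simp
  have lower: "- p (- x) \<le> p (x + s) - \<phi> s" if "s \<in> S" for x s
  proof -
    have "p s \<le> p (x + s) + p (- x)" using sublinear_add[OF p, of "x + s" "- x"] by simp
    with \<phi>_le[OF that] show ?thesis by simp
  qed
  have q_le: "q x \<le> p (x + s) - \<phi> s" if "s \<in> S" for x s
    unfolding q_def using that lower by (intro cINF_lower bdd_belowI2) auto
  have q_ge: "r \<le> q x" if "\<And>s. s \<in> S \<Longrightarrow> r \<le> p (x + s) - \<phi> s" for r x
    unfolding q_def using that S0 by (intro cINF_greatest) auto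
  show "q x \<le> p x" for x using q_le[OF S0, of x] \<phi>0 by simp
  show "q (- s) \<le> - \<phi> s" if "s \<in> S" for s using q_le[OF that, of "- s"] p by simp
  show "sublinear q"
  proof (rule sublinearI)
    fix x y
    have "q (x + y) - q y \<le> q x"
    proof (rule q_ge)
      fix s assume s: "s \<in> S"
      have "q (x + y) - (p (x + s) - \<phi> s) \<le> q y"
      proof (rule q_ge)
        fix t assume t: "t \<in> S"
        have "q (x + y) \<le> p ((x + s) + (y + t)) - \<phi> (s + t)"
          using q_le[OF S_add[OF s t], of "x + y"] by (simp add: algebra_simps)
        also have "\<dots> \<le> p (x + s) + p (y + t) - (\<phi> s + \<phi> t)"
          using sublinear_add[OF p, of "x + s" "y + t"] \<phi>_add[OF s t] by simp
        finally show "q (x + y) - (p (x + s) - \<phi> s) \<le> p (y + t) - \<phi> t" by simp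
      qed
      then show "q (x + y) - q y \<le> p (x + s) - \<phi> s" by simp
    qed
    then show "q (x + y) \<le> q x + q y" by simp
  next
    show "q 0 = 0"
      using q_le[OF S0, of 0] q_ge[of 0 0] \<phi>0 p \<phi>_le by force
  next
    fix c :: real and x
    assume c: "0 < c"
    have "q (c *\<^sub>R x) / c \<le> q x"
    proof (rule q_ge)
      fix s assume s: "s \<in> S"
      have "q (c *\<^sub>R x) \<le> p (c *\<^sub>R (x + s)) - \<phi> (c *\<^sub>R s)"
        using q_le[OF S_scale, of c s "c *\<^sub>R x"] c s by (simp add: scaleR_right_distrib)
      also have "\<dots> = c * (p (x + s) - \<phi> s)"
        using c s by (simp add: sublinear_scale[OF p] \<phi>_scale right_diff_distrib)
      finally show "q (c *\<^sub>R x) / c \<le> p (x + s) - \<phi> s" using c by (simp add: field_simps)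
    qed
    then show "q (c *\<^sub>R x) \<le> c * q x" using c by (simp add: field_simps)
  qed
qed

text \<open>Zorn's lemma. The pointwise infimum of a chain of sublinear functionals below \<open>p\<close> is finite, since
each of them is at least \<open>- p (- x)\<close>, and subadditive: of two members of the chain, the smaller one
can be used for both summands.\<close>

lemma minimal_sublinear_exists:
  fixes p :: "'a::real_vector \<Rightarrow> real"
  assumes p: "sublinear p"
  obtains m where "sublinear m" "\<And>x. m x \<le> p x"
    "\<And>q. sublinear q \<Longrightarrow> (\<And>x. q x \<le> m x) \<Longrightarrow> q = m"
proof -
  define A where "A = {q. sublinear q \<and> (\<forall>x. q x \<le> p x)}"
  define P where "P = (\<lambda>q r :: 'a \<Rightarrow> real. \<forall>x. r x \<le> q x)"
  have "\<exists>m\<in>A. \<forall>q\<in>A. P m q \<longrightarrow> q = m"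
  proof (rule predicate_Zorn)
    show "partial_order_on A (relation_of P A)"
      by (rule partial_order_on_relation_ofI) (auto simp: P_def fun_eq_iff intro: order_trans antisym)
  next
    fix C assume C: "C \<in> Chains (relation_of P A)"
    have CA: "C \<subseteq> A" using C by (rule Chains_relation_of)
    show "\<exists>u\<in>A. \<forall>q\<in>C. P q u"
    proof (cases "C = {}")
      case True
      then show ?thesis using p by (auto simp: A_def)
    next
      case False
      define u where "u = (\<lambda>x. INF q\<in>C. q x)"
      have lower: "- p (- x) \<le> q x" if "q \<in> C" for q x
      proof -
        have "sublinear q" "q (- x) \<le> p (- x)" using CA that by (auto simp: A_def)
        then show ?thesis using sublinear_ge[of q x] by simp
      qed
      have u_le: "u x \<le> q x" if "q \<in> C" for q x
        unfolding u_def using that lower by (intro cINF_lower bdd_belowI2) auto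
      have u_ge: "r \<le> u x" if "\<And>q. q \<in> C \<Longrightarrow> r \<le> q x" for r x
        unfolding u_def using that False by (intro cINF_greatest) auto
      have sub: "sublinear q" if "q \<in> C" for q using CA that by (auto simp: A_def)
      have "sublinear u"
      proof (rule sublinearI)
        fix x y
        have *: "u (x + y) \<le> q x + r y" if q: "q \<in> C" and r: "r \<in> C" for q r
        proof -
          have "P q r \<or> P r q" using C q r by (auto simp: Chains_def relation_of_def)
          then obtain m where m: "m \<in> C" "m x \<le> q x" "m y \<le> r y"
            using q r by (auto simp: P_def)
          have "u (x + y) \<le> m x + m y"
            using u_le[OF m(1), of "x + y"] sublinear_add[OF sub[OF m(1)], of x y] by simp
          with m show ?thesis by simp
        qed
        have "u (x + y) - u y \<le> u x"
        proof (rule u_ge)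
          fix q assume q: "q \<in> C"
          have "u (x + y) - q x \<le> u y" using *[OF q] by (intro u_ge) (simp add: algebra_simps)
          then show "u (x + y) - u y \<le> q x" by simp
        qed
        then show "u (x + y) \<le> u x + u y" by simp
      next
        show "u 0 = 0" unfolding u_def using sub False by simp
      next
        fix c :: real and x
        assume c: "0 < c"
        have "u (c *\<^sub>R x) / c \<le> u x"
        proof (rule u_ge)
          fix q assume q: "q \<in> C"
          show "u (c *\<^sub>R x) / c \<le> q x"
            using u_le[OF q, of "c *\<^sub>R x"] sublinear_scale[OF sub[OF q], of c x] c
            by (simp add: field_simps)
        qed
        then show "u (c *\<^sub>R x) \<le> c * u x" using c by (simp add: field_simps)
      qed
      moreover have "u x \<le> p x" for x
      proof -
        obtain q where q: "q \<in> C" using False by blast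
        then have "q x \<le> p x" using CA by (auto simp: A_def)
        with u_le[OF q, of x] show ?thesis by simp
      qed
      ultimately have "u \<in> A" by (auto simp: A_def)
      then show ?thesis using u_le by (auto simp: P_def)
    qed
  qed
  then obtain m where m: "m \<in> A" "\<And>q. q \<in> A \<Longrightarrow> P m q \<Longrightarrow> q = m" by blast
  show ?thesis
  proof (rule that)
    show "sublinear m" "m x \<le> p x" for x using m(1) by (auto simp: A_def)
    show "q = m" if "sublinear q" "\<And>x. q x \<le> m x" for q
      using that m(1) by (intro m(2)) (auto simp: A_def P_def intro: order_trans)
  qed
qed

text \<open>Relaxing a minimal \<open>m\<close> along the ray through \<open>y\<close> cannot change it, which gives
\<open>m (- y) \<le> - m y\<close>. So \<open>m\<close> is odd, and an odd sublinear functional is linear.\<close>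

lemma minimal_sublinear_linear:
  fixes m :: "'a::real_vector \<Rightarrow> real"
  assumes m: "sublinear m" and min: "\<And>q. sublinear q \<Longrightarrow> (\<And>x. q x \<le> m x) \<Longrightarrow> q = m"
  shows "linear m"
proof -
  have odd: "m (- y) = - m y" for y
  proof -
    define S where "S = {t *\<^sub>R y | t. 0 \<le> t}"
    have S: "convex_cone_with_0 S" unfolding S_def by (rule ray_convex_cone)
    have add: "m (s + t) = m s + m t" if "s \<in> S" "t \<in> S" for s t
      using sublinear_add_on_ray[OF m] that unfolding S_def .
    note relax = sublinear_relax_along_cone[OF m S, of m, OF add sublinear_scale[OF m] order_refl]
    have eq: "(\<lambda>x. INF s\<in>S. m (x + s) - m s) = m" using relax(1,2) by (intro min) simp_all
    have "y \<in> S" unfolding S_def by (intro CollectI exI[of _ 1]) simp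
    then have "m (- y) \<le> - m y" using relax(3)[of y] fun_cong[OF eq, of "- y"] by simp
    then show ?thesis using sublinear_ge[OF m, of y] by simp
  qed
  have add: "m (x + y) = m x + m y" for x y
  proof -
    have "m x \<le> m (x + y) + m (- y)" using sublinear_add[OF m, of "x + y" "- y"] by simp
    then show ?thesis using odd sublinear_add[OF m, of x y] by simp
  qed
  have "m (c *\<^sub>R x) = c * m x" for c x
  proof (cases "0 \<le> c")
    case False
    then have "m ((- c) *\<^sub>R x) = (- c) * m x" by (intro sublinear_scale[OF m]) simp
    then show ?thesis using odd[of "c *\<^sub>R x"] by simp
  qed (simp add: sublinear_scale[OF m])
  with add show ?thesis by (intro linearI) simp_all
qed

text \<open>The domination form of the Hahn-Banach theorem. With \<open>S\<close> a subspace it is the extension theorem,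
since \<open>\<phi> \<le> g\<close> at \<open>s\<close> and at \<open>- s\<close> forces equality; with \<open>S\<close> a ray it yields norming functionals.\<close>

theorem Hahn_Banach_cone:
  fixes p :: "'a::real_vector \<Rightarrow> real"
  assumes p: "sublinear p" and S: "convex_cone_with_0 S"
    and \<phi>_add: "\<And>s t. s \<in> S \<Longrightarrow> t \<in> S \<Longrightarrow> \<phi> (s + t) = \<phi> s + \<phi> t"
    and \<phi>_scale: "\<And>c s. 0 \<le> c \<Longrightarrow> s \<in> S \<Longrightarrow> \<phi> (c *\<^sub>R s) = c * \<phi> s"
    and \<phi>_le: "\<And>s. s \<in> S \<Longrightarrow> \<phi> s \<le> p s"
  obtains g where "linear g" "\<And>x. g x \<le> p x" "\<And>s. s \<in> S \<Longrightarrow> \<phi> s \<le> g s"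
proof -
  define q where "q = (\<lambda>x. INF s\<in>S. p (x + s) - \<phi> s)"
  have q: "sublinear q" "q x \<le> p x" "s \<in> S \<Longrightarrow> q (- s) \<le> - \<phi> s" for x s
    unfolding q_def using sublinear_relax_along_cone[OF p S, of \<phi>, OF \<phi>_add \<phi>_scale \<phi>_le] by auto
  obtain g where g: "sublinear g" "\<And>x. g x \<le> q x"
    "\<And>r. sublinear r \<Longrightarrow> (\<And>x. r x \<le> g x) \<Longrightarrow> r = g"
    using minimal_sublinear_exists[OF q(1)] by blast
  have lin: "linear g" by (rule minimal_sublinear_linear[OF g(1,3)])
  show ?thesis
  proof (rule that[OF lin])
    show "g x \<le> p x" for x using g(2) q(2) by (rule order_trans)
    show "\<phi> s \<le> g s" if "s \<in> S" for s
      using g(2)[of "- s"] q(3)[OF that] linear_neg[OF lin, of s] by simp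
  qed
qed

lemma blinfun_of_dominated_linear:
  fixes g :: "'a::real_normed_vector \<Rightarrow> real"
  assumes g: "linear g" and le: "\<And>x. g x \<le> c * norm x" and c: "0 \<le> c"
  obtains G :: "'a \<Rightarrow>\<^sub>L real" where "\<And>x. G x = g x" "norm G \<le> c"
proof -
  have abs_le: "\<bar>g x\<bar> \<le> c * norm x" for x
    using le[of x] le[of "- x"] linear_neg[OF g, of x] by simp
  have bl: "bounded_linear g"
    using g abs_le by (intro bounded_linear_intro[of _ c])
      (simp_all add: linear_add linear_scale mult.commute)
  show ?thesis
  proof (rule that[of "Blinfun g"])
    show *: "Blinfun g x = g x" for x using bl by (simp add: bounded_linear_Blinfun_apply)
    show "norm (Blinfun g) \<le> c" using abs_le c by (intro norm_blinfun_bound) (simp_all add: *)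
  qed
qed

corollary Hahn_Banach_blinfun:
  fixes \<Phi> :: "'a::real_normed_vector \<Rightarrow>\<^sub>L real"
  assumes S: "subspace S" and le: "\<And>s. s \<in> S \<Longrightarrow> \<Phi> s \<le> c * norm s" and c: "0 \<le> c"
  obtains \<Psi> :: "'a \<Rightarrow>\<^sub>L real" where "\<And>s. s \<in> S \<Longrightarrow> \<Psi> s = \<Phi> s" "norm \<Psi> \<le> c"
proof -
  obtain g where g: "linear g" "\<And>x. g x \<le> c * norm x" "\<And>s. s \<in> S \<Longrightarrow> \<Phi> s \<le> g s"
    by (rule Hahn_Banach_cone[OF sublinear_norm[OF c] subspace_convex_cone[OF S], of "blinfun_apply \<Phi>"])
      (use le in \<open>auto simp: blinfun.add_right blinfun.scaleR_right\<close>)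
  obtain \<Psi> :: "'a \<Rightarrow>\<^sub>L real" where \<Psi>: "\<And>x. \<Psi> x = g x" "norm \<Psi> \<le> c"
    using blinfun_of_dominated_linear[OF g(1,2) c] by blast
  show ?thesis
  proof (rule that[OF _ \<Psi>(2)])
    fix s assume s: "s \<in> S"
    have "\<Phi> (- s) \<le> g (- s)" using S s by (intro g(3)) (simp add: subspace_neg)
    then show "\<Psi> s = \<Phi> s"
      using g(3)[OF s] linear_neg[OF g(1), of s] by (simp add: \<Psi> blinfun.minus_right)
  qed
qed

text \<open>The functional is found below the seminorm \<open>y \<mapsto> dist (y, S)\<close>, which vanishes on \<open>S\<close>, by prescribing
it on the ray through \<open>x\<close>.\<close>

corollary distance_functional:
  fixes x :: "'a::real_normed_vector"
  assumes S: "subspace S" and d: "\<And>s. s \<in> S \<Longrightarrow> d \<le> norm (x + s)"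
  obtains g :: "'a \<Rightarrow>\<^sub>L real" where "norm g \<le> 1" "\<And>s. s \<in> S \<Longrightarrow> g s = 0" "d \<le> g x"
proof -
  define q where "q = (\<lambda>y. INF s\<in>S. 1 * norm (y + s) - 0)"
  have q: "sublinear q" "q y \<le> 1 * norm y" "s \<in> S \<Longrightarrow> q (- s) \<le> - 0" for y s
    unfolding q_def
    using sublinear_relax_along_cone[OF sublinear_norm[of 1] subspace_convex_cone[OF S], of "\<lambda>_. 0"]
    by simp_all
  have qx: "d \<le> q x"
    unfolding q_def using d subspace_0[OF S] by (intro cINF_greatest) auto
  define R where "R = {t *\<^sub>R x | t. 0 \<le> t}"
  have R: "convex_cone_with_0 R" unfolding R_def by (rule ray_convex_cone)
  have add: "q (s + t) = q s + q t" if "s \<in> R" "t \<in> R" for s t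
    using sublinear_add_on_ray[OF q(1)] that unfolding R_def .
  obtain g where g: "linear g" "\<And>y. g y \<le> q y" "\<And>s. s \<in> R \<Longrightarrow> q s \<le> g s"
    using Hahn_Banach_cone[OF q(1) R, of q, OF add sublinear_scale[OF q(1)] order_refl] by blast
  have "g y \<le> 1 * norm y" for y using g(2) q(2) by (rule order_trans)
  then obtain G :: "'a \<Rightarrow>\<^sub>L real" where G: "\<And>y. G y = g y" "norm G \<le> 1"
    using blinfun_of_dominated_linear[OF g(1), of 1] by auto
  show ?thesis
  proof (rule that[OF G(2)])
    fix s assume s: "s \<in> S"
    have "g (- s) \<le> 0" using g(2)[of "- s"] q(3)[OF s] by simp
    moreover have "g s \<le> 0" using g(2)[of s] q(3)[of "- s"] s S by (simp add: subspace_neg)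
    ultimately show "G s = 0" using linear_neg[OF g(1), of s] by (simp add: G)
  next
    have "x \<in> R" unfolding R_def by (intro CollectI exI[of _ 1]) simp
    then show "d \<le> G x" using qx g(3)[of x] by (simp add: G)
  qed
qed

section \<open>Finite interpolation in duality and nonreflexive spaces\<close>

text \<open>Induction on \<open>F\<close>: if \<open>n\<close> is annihilated by \<open>F\<close> and \<open>f n = 1\<close>, then every \<open>x\<close> annihilated by \<open>F\<close>
is corrected by \<open>f x *\<^sub>R n\<close> into the kernel of \<open>f\<close>, so \<open>g - g n *\<^sub>R f\<close> vanishes on the common kernel
of \<open>F\<close>.\<close>

lemma in_span_if_vanishes_on_common_kernel:
  fixes F :: "('a::real_normed_vector \<Rightarrow>\<^sub>L real) set" and g :: "'a \<Rightarrow>\<^sub>L real"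
  assumes "finite F" "\<And>x. (\<forall>f\<in>F. f x = 0) \<Longrightarrow> g x = 0"
  shows "g \<in> span F"
  using assms
proof (induction F arbitrary: g)
  case empty
  then have "g = 0" by (intro blinfun_eqI) simp
  then show ?case by simp
next
  case (insert f F)
  have mono: "span F \<subseteq> span (insert f F)" by (rule span_mono) auto
  show ?case
  proof (cases "\<forall>x. (\<forall>h\<in>F. h x = 0) \<longrightarrow> f x = 0")
    case True
    then show ?thesis using insert.IH[of g] insert.prems mono by auto
  next
    case False
    then obtain n0 where n0: "\<forall>h\<in>F. h n0 = 0" "f n0 \<noteq> 0" by blast
    define n where "n = (1 / f n0) *\<^sub>R n0"
    have n: "\<forall>h\<in>F. h n = 0" "f n = 1" using n0 by (simp_all add: n_def blinfun.scaleR_right)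
    have "g - g n *\<^sub>R f \<in> span F"
    proof (rule insert.IH)
      fix x assume x: "\<forall>h\<in>F. h x = 0"
      have "g (x - f x *\<^sub>R n) = 0"
        using x n by (intro insert.prems) (simp add: blinfun.diff_right blinfun.scaleR_right)
      then show "(g - g n *\<^sub>R f) x = 0"
        by (simp add: blinfun.diff_right blinfun.scaleR_right blinfun.diff_left blinfun.scaleR_left)
    qed
    then have "g - g n *\<^sub>R f \<in> span (insert f F)" using mono by blast
    then have "g - g n *\<^sub>R f + g n *\<^sub>R f \<in> span (insert f F)"
      by (intro span_add span_scale span_base[of f]) auto
    then show ?thesis by simp
  qed
qed

text \<open>Linear dependences between the functionals in \<open>F\<close> are respected by \<open>\<Phi>\<close> because \<open>\<Phi>\<close> is linear, so the
equations can be solved one after the other.\<close>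

lemma interpolate_bidual_element:
  fixes \<Phi> :: "('a::real_normed_vector \<Rightarrow>\<^sub>L real) \<Rightarrow>\<^sub>L real"
  assumes "finite (F :: ('a \<Rightarrow>\<^sub>L real) set)"
  shows "\<exists>x. \<forall>f\<in>F. blinfun_apply f x = \<Phi> f"
  using assms
proof (induction F)
  case (insert g F)
  then obtain x where x: "\<forall>f\<in>F. blinfun_apply f x = \<Phi> f" by blast
  show ?case
  proof (cases "\<forall>y. (\<forall>f\<in>F. blinfun_apply f y = 0) \<longrightarrow> g y = 0")
    case True
    then have "g \<in> span F" using insert.hyps by (intro in_span_if_vanishes_on_common_kernel) auto
    moreover have "subspace {h. blinfun_apply h x = \<Phi> h}"
      by (auto simp: subspace_def blinfun.add_left blinfun.add_right blinfun.scaleR_left blinfun.scaleR_right)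
    ultimately have "g x = \<Phi> g" using span_minimal[of F "{h. blinfun_apply h x = \<Phi> h}"] x by blast
    then show ?thesis using x by auto
  next
    case False
    then obtain n where n: "\<forall>f\<in>F. blinfun_apply f n = 0" "g n \<noteq> 0" by blast
    have "\<forall>f\<in>insert g F. blinfun_apply f (x + ((\<Phi> g - g x) / g n) *\<^sub>R n) = \<Phi> f"
      using x n by (simp add: blinfun.add_right blinfun.scaleR_right)
    then show ?thesis by blast
  qed
qed simp

text \<open>Helly's theorem. Start from any solution \<open>x\<close> of the equations and change it within the common kernel
\<open>N\<close>. If \<open>x\<close> were far from \<open>N\<close>, a functional \<open>g\<close> of norm at most 1 vanishing on \<open>N\<close> would have
\<open>g x > \<parallel>\<Phi>\<parallel>\<close>; but \<open>g\<close> lies in the span of \<open>F\<close>, so \<open>g x = \<Phi> g \<le> \<parallel>\<Phi>\<parallel>\<close>.\<close>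

lemma helly_points:
  fixes \<Phi> :: "('a::real_normed_vector \<Rightarrow>\<^sub>L real) \<Rightarrow>\<^sub>L real"
  assumes F: "finite F"
  obtains x where "norm x \<le> norm \<Phi> + 1" "\<And>f. f \<in> F \<Longrightarrow> blinfun_apply f x = \<Phi> f"
proof -
  obtain x where x: "\<forall>f\<in>F. blinfun_apply f x = \<Phi> f"
    using interpolate_bidual_element[OF F] by blast
  define N where "N = {y. \<forall>f\<in>F. blinfun_apply f y = 0}"
  have N: "subspace N"
    by (auto simp: N_def subspace_def blinfun.add_right blinfun.scaleR_right)
  have "\<exists>s\<in>N. norm (x + s) < norm \<Phi> + 1"
  proof (rule ccontr)
    assume "\<not> ?thesis"
    then have "\<And>s. s \<in> N \<Longrightarrow> norm \<Phi> + 1 \<le> norm (x + s)" by force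
    then obtain g :: "'a \<Rightarrow>\<^sub>L real" where g: "norm g \<le> 1" "\<And>s. s \<in> N \<Longrightarrow> g s = 0" "norm \<Phi> + 1 \<le> g x"
      using distance_functional[OF N] by blast
    have "g \<in> span F"
      using F g(2) by (intro in_span_if_vanishes_on_common_kernel) (auto simp: N_def)
    moreover have "subspace {h. blinfun_apply h x = \<Phi> h}"
      by (auto simp: subspace_def blinfun.add_left blinfun.add_right blinfun.scaleR_left blinfun.scaleR_right)
    ultimately have "g x = \<Phi> g" using span_minimal[of F "{h. blinfun_apply h x = \<Phi> h}"] x by blast
    also have "\<dots> \<le> norm \<Phi> * norm g" using norm_blinfun[of \<Phi> g] by simp
    also have "\<dots> \<le> norm \<Phi>" using g(1) by (simp add: mult_left_le)
    finally show False using g(3) by simp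
  qed
  then obtain s where s: "s \<in> N" "norm (x + s) < norm \<Phi> + 1" by blast
  show ?thesis
    by (rule that[of "x + s"]) (use s x in \<open>auto simp: N_def blinfun.add_right\<close>)
qed

definition bidual_embedding :: "'a::real_normed_vector \<Rightarrow> ('a \<Rightarrow>\<^sub>L real) \<Rightarrow>\<^sub>L real" where
  "bidual_embedding x = Blinfun (\<lambda>f. blinfun_apply f x)"

lemma bidual_embedding_apply [simp]: "blinfun_apply (bidual_embedding x) f = blinfun_apply f x"
  unfolding bidual_embedding_def
  by (simp add: bounded_linear_Blinfun_apply blinfun.bounded_linear_left)

lemma norm_bidual_embedding: "norm (bidual_embedding x) = norm x"
proof (rule antisym)
  show "norm (bidual_embedding x) \<le> norm x"
  proof (rule norm_blinfun_bound)
    show "norm (bidual_embedding x f) \<le> norm x * norm f" for f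
      using norm_blinfun[of f x] by (simp add: mult.commute)
  qed simp
  obtain g :: "'a \<Rightarrow>\<^sub>L real" where g: "norm g \<le> 1" "norm x \<le> g x"
    using distance_functional[of "{0}" "norm x" x] by auto
  have "norm x \<le> norm (bidual_embedding x g)" using g by simp
  also have "\<dots> \<le> norm (bidual_embedding x) * norm g" by (rule norm_blinfun)
  also have "\<dots> \<le> norm (bidual_embedding x)" using g(1) by (simp add: mult_left_le)
  finally show "norm x \<le> norm (bidual_embedding x)" .
qed

lemma bounded_linear_bidual_embedding: "bounded_linear bidual_embedding"
  by (intro bounded_linear_intro[of _ 1] blinfun_eqI)
    (simp_all add: norm_bidual_embedding blinfun.add_left blinfun.add_right
      blinfun.scaleR_left blinfun.scaleR_right)

text \<open>The companion of the preceding result for an element at positive distance from the canonical image.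
If \<open>\<Phi>\<close> were small on the annihilator of \<open>V\<close>, replace it there by an extension \<open>\<Psi>\<close> of small norm;
then \<open>\<Phi> - \<Psi>\<close> vanishes on the annihilator, hence comes from a vector in the span of \<open>V\<close>, and that
vector is too close to \<open>\<Phi>\<close>.\<close>

lemma helly_functionals:
  fixes \<Phi> :: "('a::real_normed_vector \<Rightarrow>\<^sub>L real) \<Rightarrow>\<^sub>L real"
  assumes d: "0 < d" "\<And>y. d \<le> norm (\<Phi> - bidual_embedding y)" and V: "finite V"
  obtains f where "norm f \<le> 2 / d" "\<And>v. v \<in> V \<Longrightarrow> blinfun_apply f v = 0" "\<Phi> f = 1"
proof -
  define A where "A = {f :: 'a \<Rightarrow>\<^sub>L real. \<forall>v\<in>V. blinfun_apply f v = 0}"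
  have A: "subspace A"
    by (auto simp: A_def subspace_def blinfun.add_left blinfun.scaleR_left)
  have "\<exists>f\<in>A. d / 2 * norm f < \<Phi> f"
  proof (rule ccontr)
    assume "\<not> ?thesis"
    then have "\<And>f. f \<in> A \<Longrightarrow> \<Phi> f \<le> d / 2 * norm f" by force
    then obtain \<Psi> :: "('a \<Rightarrow>\<^sub>L real) \<Rightarrow>\<^sub>L real" where \<Psi>: "\<And>f. f \<in> A \<Longrightarrow> \<Psi> f = \<Phi> f" "norm \<Psi> \<le> d / 2"
      using Hahn_Banach_blinfun[OF A, of \<Phi> "d / 2"] d(1) by auto
    have "\<Phi> - \<Psi> \<in> span (bidual_embedding ` V)"
      using V \<Psi>(1) by (intro in_span_if_vanishes_on_common_kernel) (auto simp: A_def blinfun.diff_left)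
    then obtain y where "\<Phi> - \<Psi> = bidual_embedding y"
      using linear_span_image[OF bounded_linear.linear[OF bounded_linear_bidual_embedding], of V] by auto
    then have "\<Phi> - bidual_embedding y = \<Psi>" by (simp add: algebra_simps)
    then show False using d(1) d(2)[of y] \<Psi>(2) by simp
  qed
  then obtain f where f: "f \<in> A" "d / 2 * norm f < \<Phi> f" by blast
  have pos: "0 < \<Phi> f" using f(2) d(1) by (smt (verit) mult_nonneg_nonneg norm_ge_zero half_gt_zero)
  show ?thesis
  proof (rule that[of "(1 / \<Phi> f) *\<^sub>R f"])
    show "norm ((1 / \<Phi> f) *\<^sub>R f) \<le> 2 / d" using f(2) pos d(1) by (simp add: field_simps)
    show "blinfun_apply ((1 / \<Phi> f) *\<^sub>R f) v = 0" if "v \<in> V" for v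
      using f(1) that by (simp add: A_def blinfun.scaleR_left)
    show "\<Phi> ((1 / \<Phi> f) *\<^sub>R f) = 1" using pos by (simp add: blinfun.scaleR_right)
  qed
qed

text \<open>The canonical image of a Banach space is complete, hence closed in the bidual.\<close>

lemma distance_to_canonical_image:
  assumes "\<not> reflexive_space TYPE('b::banach)"
  obtains \<Phi> :: "('b::banach \<Rightarrow>\<^sub>L real) \<Rightarrow>\<^sub>L real" and d where "0 < d" "\<And>y. d \<le> norm (\<Phi> - bidual_embedding y)"
proof -
  obtain \<Phi> :: "('b \<Rightarrow>\<^sub>L real) \<Rightarrow>\<^sub>L real" where \<Phi>: "\<And>y. \<exists>f. \<Phi> f \<noteq> blinfun_apply f y"
    using assms unfolding reflexive_space_def by blast
  have "\<Phi> \<notin> range bidual_embedding"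
  proof
    assume "\<Phi> \<in> range bidual_embedding"
    then obtain y where "\<Phi> = bidual_embedding y" by blast
    then show False using \<Phi>[of y] by simp
  qed
  moreover have "complete (range (bidual_embedding :: 'b \<Rightarrow> _))"
    by (rule complete_isometric_image[of 1 UNIV, OF _ _ bounded_linear_bidual_embedding])
      (simp_all add: norm_bidual_embedding complete_UNIV)
  then have "open (- range (bidual_embedding :: 'b \<Rightarrow> _))"
    by (simp add: complete_imp_closed open_Compl)
  ultimately obtain d where d: "0 < d" "ball \<Phi> d \<subseteq> - range bidual_embedding"
    unfolding open_contains_ball by blast
  show ?thesis
  proof (rule that[OF d(1)])
    fix y
    have "bidual_embedding y \<notin> ball \<Phi> d" using d(2) by blast
    then show "d \<le> norm (\<Phi> - bidual_embedding y)" by (simp add: dist_norm)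
  qed
qed

text \<open>James's criterion for nonreflexivity. The pairs \<open>(f, x)\<close> are chosen alternately: each new functional
annihilates all earlier points and has \<open>\<Phi> f = 1\<close>; each new point sees every functional chosen so far
as \<open>\<Phi>\<close> does, that is, with value 1. The functionals are shifted by one in the result because a
functional also takes the value 1 at the point chosen together with it.\<close>

lemma bounded_staircase_if_not_reflexive:
  assumes "\<not> reflexive_space TYPE('b::banach)"
  obtains M :: real and f :: "nat \<Rightarrow> ('b::banach \<Rightarrow>\<^sub>L real)" and x :: "nat \<Rightarrow> 'b"
  where "0 < M" "\<And>j. norm (f j) \<le> M" "\<And>k. norm (x k) \<le> M"
    "\<And>j k. f j (x k) = (if j < k then 1 else 0)"
proof -
  obtain \<Phi> :: "('b \<Rightarrow>\<^sub>L real) \<Rightarrow>\<^sub>L real" and d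
    where d: "0 < d" "\<And>y. d \<le> norm (\<Phi> - bidual_embedding y)"
    using distance_to_canonical_image[OF assms] by blast
  define P :: "(nat \<Rightarrow> ('b \<Rightarrow>\<^sub>L real) \<times> 'b) \<Rightarrow> nat \<Rightarrow> ('b \<Rightarrow>\<^sub>L real) \<times> 'b \<Rightarrow> bool"
    where "P h n r \<longleftrightarrow> norm (fst r) \<le> 2 / d \<and> norm (snd r) \<le> norm \<Phi> + 1 \<and>
      \<Phi> (fst r) = 1 \<and> fst r (snd r) = 1 \<and>
      (\<forall>k<n. fst r (snd (h k)) = 0 \<and> fst (h k) (snd r) = 1)" for h n r
  have "\<exists>h. \<forall>n. P h n (h n)"
  proof (rule dependent_wellorder_choice)
    show "P h n r = P h' n r" if "\<And>k. k < n \<Longrightarrow> h k = h' k" for r n and h h'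
      using that by (simp add: P_def)
  next
    fix n h
    assume IH: "\<And>k. k < n \<Longrightarrow> P h k (h k)"
    obtain f where f: "norm f \<le> 2 / d" "\<And>v. v \<in> snd ` h ` {..<n} \<Longrightarrow> blinfun_apply f v = 0" "\<Phi> f = 1"
      using helly_functionals[OF d, of "snd ` h ` {..<n}"] by auto
    obtain x where x: "norm x \<le> norm \<Phi> + 1"
      "\<And>g. g \<in> insert f (fst ` h ` {..<n}) \<Longrightarrow> blinfun_apply g x = \<Phi> g"
      using helly_points[of "insert f (fst ` h ` {..<n})" \<Phi>] by auto
    have "P h n (f, x)"
      using f x IH by (auto simp: P_def)
    then show "\<exists>r. P h n r" by blast
  qed
  then obtain h where h: "\<And>n. P h n (h n)" by blast
  show ?thesis
  proof (rule that[of "max (2 / d) (norm \<Phi> + 1)" "\<lambda>j. fst (h (Suc j))" "\<lambda>k. snd (h k)"])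
    show "0 < max (2 / d) (norm \<Phi> + 1)" using d(1) by (simp add: less_max_iff_disj)
    show "norm (fst (h (Suc j))) \<le> max (2 / d) (norm \<Phi> + 1)" for j
      using h[of "Suc j"] by (simp add: P_def le_max_iff_disj)
    show "norm (snd (h k)) \<le> max (2 / d) (norm \<Phi> + 1)" for k
      using h[of k] by (simp add: P_def le_max_iff_disj)
    show "fst (h (Suc j)) (snd (h k)) = (if j < k then 1 else 0)" for j k
    proof (cases "Suc j" k rule: linorder_cases)
      case less
      then show ?thesis using h[of k] by (simp add: P_def)
    next
      case equal
      then show ?thesis using h[of k] by (auto simp: P_def)
    next
      case greater
      then show ?thesis using h[of "Suc j"] by (simp add: P_def)
    qed
  qed
qed

section \<open>Uniformly nonsquare Banach spaces are reflexive\<close>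

lemma sorted_list_of_image_strict_mono:
  fixes p :: "nat \<Rightarrow> nat"
  assumes "strict_mono_on {..<m} p"
  shows "sorted_list_of_set (p ` {..<m}) = map p [0..<m]"
proof (rule sorted_distinct_set_unique)
  show "sorted (map p [0..<m])"
  proof -
    have "p i \<le> p j" if "i < j" "j < m" for i j
      using strict_mono_onD[OF assms, of i j] that by simp
    then show ?thesis by (auto simp: sorted_iff_nth_mono_less)
  qed
  show "distinct (map p [0..<m])"
    using strict_mono_on_imp_inj_on[OF assms] by (simp add: distinct_map atLeast0LessThan)
qed (auto simp: atLeast0LessThan)

text \<open>Ramsey's theorem for a bounded real function of increasing tuples: colour a tuple by the interval of
length \<open>\<epsilon>\<close> that contains its value.\<close>

lemma Ramsey_almost_constant:
  fixes g :: "(nat \<Rightarrow> nat) \<Rightarrow> real"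
  assumes cong: "\<And>p q. (\<And>k. k < m \<Longrightarrow> p k = q k) \<Longrightarrow> g p = g q"
    and bnd: "\<And>p. strict_mono_on {..<m} p \<Longrightarrow> 0 \<le> g p \<and> g p \<le> B"
    and "0 < \<epsilon>" "infinite Z"
  obtains H c where "H \<subseteq> Z" "infinite H"
    "\<And>p. strict_mono_on {..<m} p \<Longrightarrow> p ` {..<m} \<subseteq> H \<Longrightarrow> c \<le> g p \<and> g p < c + \<epsilon>"
proof -
  define col where "col X = nat \<lfloor>g (\<lambda>k. sorted_list_of_set X ! k) / \<epsilon>\<rfloor>" for X
  have "\<forall>X. X \<subseteq> Z \<and> finite X \<and> card X = m \<longrightarrow> col X < Suc (nat \<lfloor>B / \<epsilon>\<rfloor>)"
  proof (intro allI impI)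
    fix X assume X: "X \<subseteq> Z \<and> finite X \<and> card X = m"
    have "strict_mono_on {..<m} (\<lambda>k. sorted_list_of_set X ! k)"
      using X strict_sorted_list_of_set[of X]
      by (auto intro!: strict_mono_onI simp: sorted_wrt_iff_nth_less)
    then have "g (\<lambda>k. sorted_list_of_set X ! k) / \<epsilon> \<le> B / \<epsilon>"
      using bnd \<open>0 < \<epsilon>\<close> by (simp add: divide_right_mono)
    then have "col X \<le> nat \<lfloor>B / \<epsilon>\<rfloor>" unfolding col_def by (intro nat_mono floor_mono)
    then show "col X < Suc (nat \<lfloor>B / \<epsilon>\<rfloor>)" by simp
  qed
  from Ramsey[OF \<open>infinite Z\<close> this] obtain H t where H: "H \<subseteq> Z" "infinite H"
    and t: "\<forall>X. X \<subseteq> H \<and> finite X \<and> card X = m \<longrightarrow> col X = t" by blast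
  show ?thesis
  proof (rule that[OF H])
    fix p assume p: "strict_mono_on {..<m} p" "p ` {..<m} \<subseteq> H"
    have "card (p ` {..<m}) = m"
      using strict_mono_on_imp_inj_on[OF p(1)] by (simp add: card_image)
    then have "col (p ` {..<m}) = t" using p(2) t by simp
    moreover have "g (\<lambda>k. sorted_list_of_set (p ` {..<m}) ! k) = g p"
      unfolding sorted_list_of_image_strict_mono[OF p(1)] by (rule cong) simp
    ultimately have "nat \<lfloor>g p / \<epsilon>\<rfloor> = t" by (simp add: col_def)
    moreover have "0 \<le> g p / \<epsilon>" using bnd[OF p(1)] \<open>0 < \<epsilon>\<close> by simp
    ultimately have "\<lfloor>g p / \<epsilon>\<rfloor> = int t" by (metis nat_0_le zero_le_floor)
    then have "real t \<le> g p / \<epsilon>" "g p / \<epsilon> < real t + 1" by linarith+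
    then show "\<epsilon> * real t \<le> g p \<and> g p < \<epsilon> * real t + \<epsilon>"
      using \<open>0 < \<epsilon>\<close> by (simp add: field_simps)
  qed
qed

text \<open>The first \<open>2n\<close> values of \<open>p\<close> delimit \<open>n\<close> windows \<open>[p (2i), p (2i + 1))\<close>. On the functionals indexed by
the \<open>i\<close>-th window a member of the set has sign \<open>(-1)\<^sup>i\<close> and absolute value at least 1; between the
windows it is unconstrained.\<close>

definition alternating_set :: "(nat \<Rightarrow> ('b::real_normed_vector \<Rightarrow>\<^sub>L real)) \<Rightarrow> nat \<Rightarrow> (nat \<Rightarrow> nat) \<Rightarrow> 'b set" where
  "alternating_set f n p =
     {x. \<forall>i<n. \<forall>j. p (2 * i) \<le> j \<and> j < p (2 * i + 1) \<longrightarrow> 1 \<le> (- 1) ^ i * f j x}"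

definition alternating_norm :: "(nat \<Rightarrow> ('b::real_normed_vector \<Rightarrow>\<^sub>L real)) \<Rightarrow> nat \<Rightarrow> (nat \<Rightarrow> nat) \<Rightarrow> real" where
  "alternating_norm f n p = (INF x\<in>alternating_set f n p. norm x)"

lemma alternating_norm_le: "x \<in> alternating_set f n p \<Longrightarrow> alternating_norm f n p \<le> norm x"
  unfolding alternating_norm_def by (intro cINF_lower bdd_belowI2[of _ 0]) auto

lemma alternating_norm_cong:
  assumes "\<And>k. k < 2 * n \<Longrightarrow> p k = q k"
  shows "alternating_norm f n p = alternating_norm f n q"
proof -
  have "p (2 * i) = q (2 * i)" "p (2 * i + 1) = q (2 * i + 1)" if "i < n" for i
    using that by (auto intro!: assms)
  then have "alternating_set f n p = alternating_set f n q" by (auto simp: alternating_set_def)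
  then show ?thesis by (simp add: alternating_norm_def)
qed

text \<open>The constraints are convex, and shrinking the windows weakens them.\<close>

lemma alternating_set_midpoint:
  assumes x: "x \<in> alternating_set f n p" and y: "y \<in> alternating_set f n q"
    and r: "\<And>i. i < n \<Longrightarrow> p (2 * i) \<le> r (2 * i)" "\<And>i. i < n \<Longrightarrow> q (2 * i) \<le> r (2 * i)"
      "\<And>i. i < n \<Longrightarrow> r (2 * i + 1) \<le> p (2 * i + 1)" "\<And>i. i < n \<Longrightarrow> r (2 * i + 1) \<le> q (2 * i + 1)"
  shows "(1/2) *\<^sub>R (x + y) \<in> alternating_set f n r"
  unfolding alternating_set_def
proof (intro CollectI allI impI)
  fix i j assume i: "i < n" and j: "r (2 * i) \<le> j \<and> j < r (2 * i + 1)"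
  have "1 \<le> (- 1) ^ i * f j x" "1 \<le> (- 1) ^ i * f j y"
    using x y i j r[OF i] unfolding alternating_set_def by force+
  then show "1 \<le> (- 1) ^ i * f j ((1/2) *\<^sub>R (x + y))"
    by (simp add: blinfun.scaleR_right blinfun.add_right distrib_left)
qed

text \<open>Dropping the first window reverses all the remaining signs.\<close>

lemma alternating_set_shift:
  assumes x: "x \<in> alternating_set f (Suc n) p"
  shows "- x \<in> alternating_set f n (\<lambda>k. p (k + 2))"
  unfolding alternating_set_def
proof (intro CollectI allI impI)
  fix i j assume "i < n" and "p (2 * i + 2) \<le> j \<and> j < p (2 * i + 1 + 2)"
  then have "1 \<le> (- 1) ^ Suc i * f j x"
    using x unfolding alternating_set_def by (elim CollectE allE[of _ "Suc i"]) simp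
  then show "1 \<le> (- 1) ^ i * f j (- x)" by (simp add: blinfun.minus_right)
qed

lemma alternating_set_Suc: "alternating_set f (Suc n) p \<subseteq> alternating_set f n p"
  by (auto simp: alternating_set_def)

context
  fixes f :: "nat \<Rightarrow> ('b::real_normed_vector \<Rightarrow>\<^sub>L real)" and x :: "nat \<Rightarrow> 'b" and M :: real
  assumes M: "0 < M" and norm_f: "\<And>j. norm (f j) \<le> M" and norm_x: "\<And>k. norm (x k) \<le> M"
    and staircase: "\<And>j k. f j (x k) = (if j < k then 1 else 0)"
begin

text \<open>The functional \<open>f j\<close> takes on \<open>x b - x a\<close> the value 1 if \<open>a \<le> j < b\<close> and 0 otherwise, so such
differences with alternating signs, one for each window, meet the constraints exactly. The point of
the bound on the norm is that it is linear in the number of windows.\<close>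

lemma alternating_set_witness:
  assumes p: "strict_mono_on {..<2 * n} p"
  obtains z where "z \<in> alternating_set f n p" "norm z \<le> 2 * real n * M"
proof -
  define z where "z = (\<Sum>i<n. (- 1) ^ i *\<^sub>R (x (p (2 * i + 1)) - x (p (2 * i))))"
  have mono: "p a < p b" if "a < b" "b < 2 * n" for a b
    using strict_mono_onD[OF p, of a b] that by simp
  have "1 \<le> (- 1) ^ i * f j z" if i: "i < n" and j: "p (2 * i) \<le> j" "j < p (2 * i + 1)" for i j
  proof -
    have term_eq: "f j (x (p (2 * i' + 1)) - x (p (2 * i'))) = (if i' = i then 1 else 0)" if "i' < n" for i'
    proof (cases i' i rule: linorder_cases)
      case less
      then have "p (2 * i') < p (2 * i)" "p (2 * i' + 1) < p (2 * i)" using i by (auto intro!: mono)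
      then show ?thesis using less j by (simp add: blinfun.diff_right staircase)
    next
      case equal
      then show ?thesis using j by (simp add: blinfun.diff_right staircase)
    next
      case greater
      have "p (2 * i + 1) < p (2 * i')" using greater that by (intro mono) auto
      moreover have "p (2 * i + 1) < p (2 * i' + 1)" using greater that by (intro mono) auto
      ultimately show ?thesis using greater j by (simp add: blinfun.diff_right staircase)
    qed
    have "f j z = (\<Sum>i'<n. (- 1) ^ i' * f j (x (p (2 * i' + 1)) - x (p (2 * i'))))"
      by (simp add: z_def blinfun.sum_right blinfun.scaleR_right)
    also have "\<dots> = (\<Sum>i'<n. if i' = i then (- 1) ^ i' else 0)"
      by (intro sum.cong) (simp_all add: term_eq[simplified])
    also have "\<dots> = (- 1) ^ i" using i by simp
    finally show ?thesis by (simp flip: power_mult_distrib)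
  qed
  then have "z \<in> alternating_set f n p" by (auto simp: alternating_set_def)
  moreover have "norm z \<le> (\<Sum>i<n. 2 * M)"
    unfolding z_def
  proof (rule sum_norm_le)
    fix i assume "i \<in> {..<n}"
    have "norm ((- 1) ^ i *\<^sub>R (x (p (2 * i + 1)) - x (p (2 * i)))) = norm (x (p (2 * i + 1)) - x (p (2 * i)))"
      by (simp add: power_abs)
    also have "\<dots> \<le> norm (x (p (2 * i + 1))) + norm (x (p (2 * i)))" by (rule norm_triangle_ineq4)
    also have "\<dots> \<le> 2 * M" using norm_x[of "p (2 * i + 1)"] norm_x[of "p (2 * i)"] by simp
    finally show "norm ((- 1) ^ i *\<^sub>R (x (p (2 * i + 1)) - x (p (2 * i)))) \<le> 2 * M" .
  qed
  ultimately show ?thesis using that by simp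
qed

lemma alternating_norm_bounds:
  assumes p: "strict_mono_on {..<2 * n} p"
  shows "0 \<le> alternating_norm f n p" "alternating_norm f n p \<le> 2 * real n * M"
    "1 \<le> n \<Longrightarrow> 1 / M \<le> alternating_norm f n p"
    "alternating_norm f n p < r \<Longrightarrow> \<exists>z\<in>alternating_set f n p. norm z < r"
proof -
  obtain z where z: "z \<in> alternating_set f n p" "norm z \<le> 2 * real n * M"
    using alternating_set_witness[OF p] by blast
  show "alternating_norm f n p \<le> 2 * real n * M" using alternating_norm_le[OF z(1)] z(2) by simp
  show "0 \<le> alternating_norm f n p"
    unfolding alternating_norm_def using z(1) by (intro cINF_greatest) auto
  show "\<exists>z\<in>alternating_set f n p. norm z < r" if "alternating_norm f n p < r"
  proof -
    have "bdd_below (norm ` alternating_set f n p)" by (rule bdd_belowI2[of _ 0]) simp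
    then show ?thesis
      using that z(1) cINF_less_iff[of "alternating_set f n p" norm r]
      unfolding alternating_norm_def by blast
  qed
  show "1 / M \<le> alternating_norm f n p" if n: "1 \<le> n"
    unfolding alternating_norm_def
  proof (rule cINF_greatest)
    fix y assume "y \<in> alternating_set f n p"
    moreover have "p 0 < p 1" using strict_mono_onD[OF p, of 0 1] n by simp
    ultimately have "1 \<le> f (p 0) y" using n by (auto simp: alternating_set_def)
    also have "\<dots> \<le> norm (f (p 0)) * norm y" using norm_blinfun[of "f (p 0)" y] by simp
    also have "\<dots> \<le> M * norm y" using norm_f by (simp add: mult_right_mono)
    finally show "1 / M \<le> norm y" using M by (simp add: field_simps)
  qed (use z(1) in auto)
qed

text \<open>Applying Ramsey's theorem for each number of windows in turn gives one index set that serves them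
all.\<close>

lemma alternating_norm_almost_constant:
  assumes "0 < \<epsilon>"
  shows "\<exists>H c. infinite H \<and> (\<forall>n\<le>N. \<forall>p. strict_mono_on {..<2 * n} p \<longrightarrow> p ` {..<2 * n} \<subseteq> H \<longrightarrow>
    c n \<le> alternating_norm f n p \<and> alternating_norm f n p < c n + \<epsilon>)"
proof (induction N)
  case 0
  have "alternating_norm f 0 p = alternating_norm f 0 id" for p by (rule alternating_norm_cong) simp
  then have "alternating_norm f 0 id \<le> alternating_norm f 0 p \<and>
      alternating_norm f 0 p < alternating_norm f 0 id + \<epsilon>" for p
    using assms by (metis order_refl less_add_same_cancel1)
  then show ?case
    by (intro exI[of _ UNIV] exI[of _ "\<lambda>_. alternating_norm f 0 id"]) simp
next
  case (Suc N)
  then obtain Z c where Z: "infinite Z" "\<And>n p. n \<le> N \<Longrightarrow> strict_mono_on {..<2 * n} p \<Longrightarrow>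
      p ` {..<2 * n} \<subseteq> Z \<Longrightarrow> c n \<le> alternating_norm f n p \<and> alternating_norm f n p < c n + \<epsilon>"
    by blast
  obtain H c' where H: "H \<subseteq> Z" "infinite H"
    "\<And>p. strict_mono_on {..<2 * Suc N} p \<Longrightarrow> p ` {..<2 * Suc N} \<subseteq> H \<Longrightarrow>
       c' \<le> alternating_norm f (Suc N) p \<and> alternating_norm f (Suc N) p < c' + \<epsilon>"
  proof (rule Ramsey_almost_constant[of "2 * Suc N" "alternating_norm f (Suc N)" "2 * real (Suc N) * M" \<epsilon> Z])
    show "0 \<le> alternating_norm f (Suc N) p \<and> alternating_norm f (Suc N) p \<le> 2 * real (Suc N) * M"
      if "strict_mono_on {..<2 * Suc N} p" for p
      using alternating_norm_bounds(1,2)[OF that] by blast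
  qed (use assms Z(1) in \<open>blast intro: alternating_norm_cong\<close>)+
  have "(c(Suc N := c')) n \<le> alternating_norm f n p \<and> alternating_norm f n p < (c(Suc N := c')) n + \<epsilon>"
    if "n \<le> Suc N" "strict_mono_on {..<2 * n} p" "p ` {..<2 * n} \<subseteq> H" for n p
    using that Z(2)[of n p] H(1) H(3)[of p] by (cases "n = Suc N") auto
  then show ?case using H(2) by blast
qed

text \<open>The heart of the argument. Choose near-minimizers \<open>a\<close> and \<open>b\<close> for two interlaced systems of
\<open>N + 1\<close> windows. The \<open>i\<close>-th window of \<open>q\<close> meets both the \<open>i\<close>-th and the next window of \<open>p\<close>. On the
first overlap \<open>a\<close> and \<open>b\<close> have the same sign, so their half sum is again alternating with \<open>N + 1\<close>
windows; on the second they have opposite signs, so their half difference is alternating with \<open>N\<close>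
windows. Nonsquareness makes one of the two short.\<close>

lemma alternating_norm_growth:
  assumes \<kappa>: "\<And>x y :: 'b. norm x \<le> 1 \<Longrightarrow> norm y \<le> 1 \<Longrightarrow> norm (x + y) \<le> 2 * \<kappa> \<or> norm (x - y) \<le> 2 * \<kappa>"
    and H: "infinite H" and r: "0 < r"
    and c: "\<And>n p. n \<in> {N, Suc N} \<Longrightarrow> strict_mono p \<Longrightarrow> range p \<subseteq> H \<Longrightarrow> c n \<le> alternating_norm f n p"
    and upper: "\<And>p. strict_mono p \<Longrightarrow> range p \<subseteq> H \<Longrightarrow> alternating_norm f (Suc N) p < r"
  shows "c (Suc N) \<le> \<kappa> * r \<or> c N \<le> \<kappa> * r"
proof -
  define h where "h = enumerate H"
  have h: "strict_mono h" unfolding h_def using H by (simp add: strict_mono_enumerate)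
  have h_H: "h k \<in> H" for k unfolding h_def using H by (rule enumerate_in_set)
  have *: "strict_mono (\<lambda>k. h (g k)) \<and> range (\<lambda>k. h (g k)) \<subseteq> H" if "\<And>k. g k < g (Suc k)" for g
    using that h h_H by (auto simp: strict_mono_Suc_iff strict_mono_less)
  \<comment> \<open>In terms of positions in \<open>H\<close>, the \<open>i\<close>-th windows are \<open>[4i, 4i + 3)\<close> for \<open>p\<close>, \<open>[4i + 2, 4i + 5)\<close> for \<open>q\<close>,
    \<open>[4i + 2, 4i + 3)\<close> for the overlap \<open>u\<close> and \<open>[4i + 4, 4i + 5)\<close> for the overlap \<open>v\<close>.\<close>
  define p where "p = (\<lambda>k. h (2 * k + (if odd k then 1 else 0)))"
  define q where "q = (\<lambda>k. h (2 * k + (if odd k then 1 else 0) + 2))"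
  define u where "u = (\<lambda>k. h (2 * k + (if odd k then 1 else 2)))"
  define v where "v = (\<lambda>k. h (2 * k + (if odd k then 3 else 4)))"
  have p: "strict_mono p \<and> range p \<subseteq> H" unfolding p_def by (rule *) auto
  have q: "strict_mono q \<and> range q \<subseteq> H" unfolding q_def by (rule *) auto
  have u: "strict_mono u \<and> range u \<subseteq> H" unfolding u_def by (rule *) auto
  have v: "strict_mono v \<and> range v \<subseteq> H" unfolding v_def by (rule *) auto
  have le: "h a \<le> h b" if "a \<le> b" for a b using h that by (simp add: strict_mono_less_eq)
  have mono_on: "strict_mono_on A p'" if "strict_mono p'" for p' :: "nat \<Rightarrow> nat" and A
    using that by (simp add: strict_mono_on_def strict_mono_def)
  obtain a where a: "a \<in> alternating_set f (Suc N) p" "norm a < r"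
    using alternating_norm_bounds(4)[OF mono_on] p upper by blast
  obtain b where b: "b \<in> alternating_set f (Suc N) q" "norm b < r"
    using alternating_norm_bounds(4)[OF mono_on] q upper by blast
  have "(1/2) *\<^sub>R (a + b) \<in> alternating_set f (Suc N) u"
    by (rule alternating_set_midpoint[OF a(1) b(1)]) (auto simp: p_def q_def u_def intro!: le)
  then have 1: "c (Suc N) \<le> norm (a + b) / 2"
    using c[of "Suc N" u] u alternating_norm_le by fastforce
  have "(1/2) *\<^sub>R (- a + b) \<in> alternating_set f N v"
    by (rule alternating_set_midpoint[OF alternating_set_shift[OF a(1)] alternating_set_Suc[THEN subsetD, OF b(1)]])
      (auto simp: p_def q_def v_def intro!: le)
  then have 2: "c N \<le> norm (a - b) / 2"
    using c[of N v] v alternating_norm_le[of "(1/2) *\<^sub>R (- a + b)" f N v] norm_minus_commute[of a b] by simp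
  have "norm (a + b) \<le> 2 * \<kappa> * r \<or> norm (a - b) \<le> 2 * \<kappa> * r"
    using a(2) b(2) r by (intro nonsquare_scaled \<kappa>) simp_all
  then show ?thesis using 1 2 by auto
qed

text \<open>In a uniformly nonsquare space the preceding dichotomy makes the (almost constant) alternating norms
grow geometrically in the number of windows, whereas they are bounded linearly.\<close>

lemma staircase_imp_not_uniformly_nonsquare: "\<not> uniformly_nonsquare TYPE('b)"
proof
  assume "uniformly_nonsquare TYPE('b)"
  then obtain \<kappa> where \<kappa>1: "\<kappa> < 1" and \<kappa>: "\<And>x y :: 'b. norm x \<le> 1 \<Longrightarrow> norm y \<le> 1 \<Longrightarrow>
     norm (x + y) \<le> 2 * \<kappa> \<or> norm (x - y) \<le> 2 * \<kappa>"
    unfolding uniformly_nonsquare_def by blast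
  have \<kappa>0: "0 \<le> \<kappa>" using \<kappa>[of 0 0] by simp
  \<comment> \<open>The alternating norms are at least \<open>1 / M\<close>, so this \<open>\<epsilon>\<close> is less than the fraction \<open>(1 - \<kappa>) / 2\<close> of
    each number \<open>c n + \<epsilon>\<close> with \<open>n \<ge> 1\<close>. That excludes the first alternative of the dichotomy, and the
    second becomes \<open>c n + \<epsilon> \<le> \<beta> * (c (Suc n) + \<epsilon>)\<close>.\<close>
  define \<epsilon> where "\<epsilon> = (1 - \<kappa>) / (2 * M)"
  have \<epsilon>: "0 < \<epsilon>" using \<kappa>1 M by (simp add: \<epsilon>_def)
  define \<beta> where "\<beta> = 2 * \<kappa> / (1 + \<kappa>)"
  have \<beta>: "0 \<le> \<beta>" "\<beta> < 1" using \<kappa>0 \<kappa>1 by (simp_all add: \<beta>_def)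
  have "(\<lambda>k. 2 * M * (real k * \<beta> ^ k) + (2 * M + \<epsilon>) * \<beta> ^ k) \<longlonglongrightarrow> 2 * M * 0 + (2 * M + \<epsilon>) * 0"
    using \<beta> by (intro tendsto_intros powser_times_n_limit_0 LIMSEQ_realpow_zero) simp_all
  then have "(\<lambda>k. 2 * M * (real k * \<beta> ^ k) + (2 * M + \<epsilon>) * \<beta> ^ k) \<longlonglongrightarrow> 0" by simp
  from order_tendstoD(2)[OF this, of "1 / M"] M
  obtain K where K: "2 * M * (real K * \<beta> ^ K) + (2 * M + \<epsilon>) * \<beta> ^ K < 1 / M"
    by (auto simp: eventually_sequentially)
  obtain H c where H: "infinite H" and c: "\<And>n p. n \<le> Suc K \<Longrightarrow> strict_mono_on {..<2 * n} p \<Longrightarrow>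
      p ` {..<2 * n} \<subseteq> H \<Longrightarrow> c n \<le> alternating_norm f n p \<and> alternating_norm f n p < c n + \<epsilon>"
    using alternating_norm_almost_constant[OF \<epsilon>, of "Suc K"] by blast
  have c': "c n \<le> alternating_norm f n p \<and> alternating_norm f n p < c n + \<epsilon>"
    if "n \<le> Suc K" "strict_mono p" "range p \<subseteq> H" for n p
    using that by (intro c) (auto simp: strict_mono_on_def strict_mono_def)
  define h where "h = enumerate H"
  have h: "strict_mono h" "range h \<subseteq> H"
    unfolding h_def using H by (auto simp: strict_mono_enumerate enumerate_in_set)
  then have h_on: "strict_mono_on A h" for A by (simp add: strict_mono_on_def strict_mono_def)
  have lower: "1 / M < c n + \<epsilon>" if "1 \<le> n" "n \<le> Suc K" for n
    using c'[OF that(2) h] alternating_norm_bounds(3)[OF h_on that(1)] by linarith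
  have step: "c n + \<epsilon> \<le> \<beta> * (c (Suc n) + \<epsilon>)" if n: "1 \<le> n" "n \<le> K" for n
  proof -
    have pos: "1 / M < c (Suc n) + \<epsilon>" "1 / M < c n + \<epsilon>" using lower n by auto
    then have r: "0 < c (Suc n) + \<epsilon>" using M by (smt (verit) divide_pos_pos)
    have "c (Suc n) \<le> \<kappa> * (c (Suc n) + \<epsilon>) \<or> c n \<le> \<kappa> * (c (Suc n) + \<epsilon>)"
      using n c' by (intro alternating_norm_growth[OF \<kappa> H r]) auto
    moreover have "\<epsilon> < (1 - \<kappa>) / 2 * t" if "1 / M < t" for t
    proof -
      have "\<epsilon> = (1 - \<kappa>) / 2 * (1 / M)" by (simp add: \<epsilon>_def)
      also have "\<dots> < (1 - \<kappa>) / 2 * t" using \<kappa>1 that by (intro mult_strict_left_mono) simp_all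
      finally show ?thesis .
    qed
    then have "\<epsilon> < (1 - \<kappa>) / 2 * (c (Suc n) + \<epsilon>)" "\<epsilon> < (1 - \<kappa>) / 2 * (c n + \<epsilon>)"
      using pos by blast+
    moreover have "\<not> c (Suc n) \<le> \<kappa> * (c (Suc n) + \<epsilon>)"
    proof
      assume "c (Suc n) \<le> \<kappa> * (c (Suc n) + \<epsilon>)"
      then have "(1 - \<kappa>) * (c (Suc n) + \<epsilon>) \<le> \<epsilon>" by (simp add: algebra_simps)
      moreover have "2 * \<epsilon> < (1 - \<kappa>) * (c (Suc n) + \<epsilon>)"
        using \<open>\<epsilon> < (1 - \<kappa>) / 2 * (c (Suc n) + \<epsilon>)\<close> by simp
      ultimately show False using \<epsilon> by simp
    qed
    ultimately have "c n \<le> \<kappa> * (c (Suc n) + \<epsilon>)" "\<epsilon> < (1 - \<kappa>) / 2 * (c n + \<epsilon>)" by blast+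
    then have "(1 + \<kappa>) * (c n + \<epsilon>) \<le> 2 * \<kappa> * (c (Suc n) + \<epsilon>)" by (simp add: field_simps)
    then show ?thesis using \<kappa>0 by (simp add: \<beta>_def field_simps)
  qed
  have "c 1 + \<epsilon> \<le> \<beta> ^ k * (c (Suc k) + \<epsilon>)" if "k \<le> K" for k
    using that
  proof (induction k)
    case (Suc k)
    then have "c 1 + \<epsilon> \<le> \<beta> ^ k * (c (Suc k) + \<epsilon>)" by simp
    also have "\<dots> \<le> \<beta> ^ k * (\<beta> * (c (Suc (Suc k)) + \<epsilon>))"
      using Suc.prems \<beta> by (intro mult_left_mono step) simp_all
    finally show ?case by (simp add: mult_ac)
  qed simp
  then have "c 1 + \<epsilon> \<le> \<beta> ^ K * (c (Suc K) + \<epsilon>)" by simp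
  also have "\<dots> \<le> \<beta> ^ K * (2 * real (Suc K) * M + \<epsilon>)"
    using \<beta> c'[OF order_refl h] alternating_norm_bounds(2)[OF h_on, of "Suc K"]
    by (intro mult_left_mono) auto
  also have "\<dots> < 1 / M" using K by (simp add: algebra_simps)
  finally show False using lower[of 1] by simp
qed

end

theorem uniformly_nonsquare_imp_reflexive:
  assumes "uniformly_nonsquare TYPE('b::banach)"
  shows "reflexive_space TYPE('b)"
proof (rule ccontr)
  assume "\<not> reflexive_space TYPE('b)"
  then obtain M :: real and f :: "nat \<Rightarrow> ('b \<Rightarrow>\<^sub>L real)" and x :: "nat \<Rightarrow> 'b"
    where "0 < M" "\<And>j. norm (f j) \<le> M" "\<And>k. norm (x k) \<le> M"
      "\<And>j k. f j (x k) = (if j < k then 1 else 0)"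
    using bounded_staircase_if_not_reflexive by blast
  from staircase_imp_not_uniformly_nonsquare[OF this] assms show False by contradiction
qed

section \<open>Superreflexivity\<close>

theorem corollary6p8:
  assumes "\<exists>x :: 'a::banach_lattice. x \<noteq> 0"
    and "eps_tilde_0m TYPE('a) + riesz_angle TYPE('a) < 2"
  shows "superreflexive TYPE('a) TYPE('b::banach)"
proof -
  have "uniformly_nonsquare TYPE('a)"
    using assms uniformly_nonsquare_banach_lattice by blast
  then show ?thesis
    unfolding superreflexive_def
    using uniformly_nonsquare_finitely_representable uniformly_nonsquare_imp_reflexive by blast
qed

end
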